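(* Let $s\in\mathbb{N}$ and let $k\in\mathbb{Z}$. If $k\neq 0$, then the representer of $I_k$ for the space $\widetilde H^s$, i.e. the function $\tilde h_{k,s}\in\widetilde H^s$ with $I_k(f)=\langle f,\tilde h_{k,s}\rangle_s$ for all $f\in\widetilde H^s$, is $$\tilde h_{k,s}(x)=(2\pi k)^{-2s}\,e^{2\pi i kx},\qquad x\in[0,1],$$ and the initial error is $$\tilde e(0,k,s)=\|\tilde h_{k,s}\|_{H^s}=\frac{1}{(2\pi|k|)^s}.$$ For $k=0$ we have $\tilde h_{0,s}(x)=1$ for all $x\in[0,1]$ and $\tilde e(0,0,s)=1$.
   Context: For $s\in\mathbb{N}=\{1,2,\dots\}$ let $H^s=\{f:[0,1]\to\mathbb{C} : f^{(s-1)}\text{ is absolutely continuous},\ f^{(s)}\in L_2([0,1])\}$ with inner product $$\langle f,g\rangle_s=\sum_{\ell=0}^{s-1}\int_0^1 f^{(\ell)}(x)\,dx\ \int_0^1\overline{g^{(\ell)}(x)}\,dx+\int_0^1 f^{(s)}(x)\,\overline{g^{(s)}(x)}\,dx$$ and norm $\|f\|_{H^s}=\langle f,f\rangle_s^{1/2}$. The periodic subspace is $\widetilde H^s=\{f\in H^s : f^{(\ell)}(0)=f^{(\ell)}(1)\text{ for }\ell=0,1,\dots,s-1\}$ with the same inner product. For $k\in\mathbb{Z}$, $I_k(f)=\int_0^1 f(x)\,e^{-2\pi i kx}\,dx$. The initial error is $\tilde e(0,k,s)=\sup\{|I_k(f)| : f\in\widetilde H^s,\ \|f\|_{H^s}\le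 1\}$. *)

theory Defs
  imports "HOL-Analysis.Analysis"
begin

text \<open>
  A function on \<open>[0,1]\<close> is represented by a total function \<open>real \<Rightarrow> complex\<close> whose values
  outside \<open>[0,1]\<close> are irrelevant: all notions below only depend on the restriction to \<open>[0,1]\<close>,
  and derivatives at the end points are one-sided.
\<close>

text \<open>A finite set \<open>D\<close> of pairs encodes a finite family of non-overlapping intervals.\<close>

definition abs_cont_on :: "real \<Rightarrow> real \<Rightarrow> (real \<Rightarrow> complex) \<Rightarrow> bool" where
  "abs_cont_on a b f \<longleftrightarrow>
     (\<forall>\<epsilon>>0. \<exists>\<delta>>0. \<forall>D.
        finite D \<and> (\<forall>(u, v)\<in>D. a \<le> u \<and> u \<le> v \<and> v \<le> b) \<and>
        pairwise (\<lambda>p q. disjnt {fst p<..<snd p} {fst q<..<snd q}) D \<and>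
        (\<Sum>(u, v)\<in>D. v - u) < \<delta>
        \<longrightarrow> (\<Sum>(u, v)\<in>D. norm (f v - f u)) < \<epsilon>)"

definition L2_01 :: "(real \<Rightarrow> complex) \<Rightarrow> bool" where
  "L2_01 g \<longleftrightarrow> set_borel_measurable lebesgue {0..1} g \<and>
     set_integrable lebesgue {0..1} (\<lambda>x. (norm (g x))\<^sup>2)"

definition deriv01 :: "nat \<Rightarrow> (real \<Rightarrow> complex) \<Rightarrow> real \<Rightarrow> complex" where
  "deriv01 l = (\<lambda>g x. vector_derivative g (at x within {0..1})) ^^ l"

text \<open>
  The derivatives of order below \<open>s\<close> exist everywhere on \<open>[0,1]\<close>, the one of order \<open>s\<close> only
  almost everywhere. \<^const>\<open>vector_derivative\<close> is total, so the existence of the derivatives is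
  stated explicitly. The almost-everywhere clause only expresses that \<open>f\<^sup>(\<^sup>s\<^sup>)\<close> is well
  defined; by Lebesgue's differentiation theorem it follows from absolute continuity.
\<close>

definition sobolev :: "nat \<Rightarrow> (real \<Rightarrow> complex) set" where
  "sobolev s = {f.
     (\<forall>l<s - 1. \<forall>x\<in>{0..1}. deriv01 l f differentiable (at x within {0..1})) \<and>
     abs_cont_on 0 1 (deriv01 (s - 1) f) \<and>
     (AE x\<in>{0..1} in lebesgue. deriv01 (s - 1) f differentiable (at x within {0..1})) \<and>
     L2_01 (deriv01 s f)}"

definition sobolev_inner :: "nat \<Rightarrow> (real \<Rightarrow> complex) \<Rightarrow> (real \<Rightarrow> complex) \<Rightarrow> complex" where
  "sobolev_inner s f g =
     (\<Sum>l<s. (LINT x:{0..1}|lebesgue. deriv01 l f x) *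
             (LINT x:{0..1}|lebesgue. cnj (deriv01 l g x))) +
     (LINT x:{0..1}|lebesgue. deriv01 s f x * cnj (deriv01 s g x))"

definition sobolev_norm :: "nat \<Rightarrow> (real \<Rightarrow> complex) \<Rightarrow> real" where
  "sobolev_norm s f = sqrt (Re (sobolev_inner s f f))"

definition periodic_sobolev :: "nat \<Rightarrow> (real \<Rightarrow> complex) set" where
  "periodic_sobolev s = {f \<in> sobolev s. \<forall>l<s. deriv01 l f 0 = deriv01 l f 1}"

definition fourier_int :: "int \<Rightarrow> (real \<Rightarrow> complex) \<Rightarrow> complex" where
  "fourier_int k f =
     (LINT x:{0..1}|lebesgue. f x * exp (- 2 * of_real pi * \<i> * of_int k * of_real x))"

definition is_representer :: "int \<Rightarrow> nat \<Rightarrow> (real \<Rightarrow> complex) \<Rightarrow> bool" where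
  "is_representer k s h \<longleftrightarrow> h \<in> periodic_sobolev s \<and>
     (\<forall>f\<in>periodic_sobolev s. fourier_int k f = sobolev_inner s f h)"

text \<open>The supremum is taken in \<^typ>\<open>ereal\<close>, so that no boundedness is presupposed.\<close>

definition initial_error :: "int \<Rightarrow> nat \<Rightarrow> ereal" where
  "initial_error k s =
     (SUP f\<in>{f \<in> periodic_sobolev s. sobolev_norm s f \<le> 1}. ereal (norm (fourier_int k f)))"

end

theory Submission
  imports Defs
begin

text \<open>
  Write \<open>e\<^sub>k\<close> for the Fourier mode \<open>x \<mapsto> exp (2 \<pi> i k x)\<close>. It is an eigenfunction of
  differentiation with eigenvalue \<open>2 \<pi> i k\<close>. For periodic \<open>f\<close> integration by parts has no
  boundary terms, so the \<open>k\<close>-th Fourier coefficient of \<open>f\<^sup>(\<^sup>s\<^sup>)\<close> is \<open>(2 \<pi> i k)\<^sup>s I\<^sub>k(f)\<close>.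
  Among the mean-value terms of the inner product with \<open>e\<^sub>k\<close> only one can survive, namely the
  one of order \<open>0\<close> for \<open>k = 0\<close>, because every other mode and every derivative of the constant
  mode has mean zero. Together this gives \<open>\<langle>f, e\<^sub>k\<rangle> = w\<^sub>k I\<^sub>k(f)\<close> with \<open>w\<^sub>k = (2 \<pi> k)\<^bsup>2s\<^esup>\<close> for
  \<open>k \<noteq> 0\<close> and \<open>w\<^sub>0 = 1\<close> (lemma \<open>sobolev_inner_mode\<close>), which says that \<open>e\<^sub>k / w\<^sub>k\<close> represents \<open>I\<^sub>k\<close>.

  The remaining claims are Hilbert space geometry. A representer is unique on \<open>[0,1]\<close> because
  the inner product is definite there (\<open>sobolev_inner_definite\<close>). The projection
  \<open>f - I\<^sub>k(f) e\<^sub>k\<close> is orthogonal to \<open>e\<^sub>k\<close>, so its squared norm \<open>\<parallel>f\<parallel>\<^sup>2 - w\<^sub>k |I\<^sub>k(f)|\<^sup>2\<close> is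
  nonnegative (\<open>sobolev_bessel\<close>), which bounds the initial error by \<open>w\<^sub>k\<^bsup>-1/2\<^esup>\<close>; the normalised
  mode \<open>e\<^sub>k / \<surd>w\<^sub>k\<close> attains the bound.

  The analytic content is the fundamental theorem of calculus for absolutely continuous
  functions (\<open>fundamental_theorem_of_calculus_abs_cont\<close>): it is needed both for the integration
  by parts at the top order, where the derivative exists only almost everywhere, and for
  definiteness, where a vanishing derivative must force the function to be constant.
\<close>

section \<open>Absolutely continuous functions\<close>

text \<open>
  The criterion behind closure under products and linear combinations: it suffices to bound
  the increments of \<open>h\<close> by those of functions already known to be absolutely
  continuous.
\<close>

lemma abs_cont_on_dominated:
  assumes f: "abs_cont_on a b f" and g: "abs_cont_on a b g"
    and h: "\<And>u v. a \<le> u \<Longrightarrow> u \<le> v \<Longrightarrow> v \<le> b \<Longrightarrow>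
        norm (h v - h u) \<le> A * norm (f v - f u) + B * norm (g v - g u)"
  shows "abs_cont_on a b h"
  unfolding abs_cont_on_def
proof (intro allI impI)
  fix e :: real assume "0 < e"
  define C where "C = max \<bar>A\<bar> \<bar>B\<bar> + 1"
  have C: "0 < C" "A \<le> C" "B \<le> C" by (auto simp: C_def)
  define e' where "e' = e / (2 * C)"
  have "0 < e'" using \<open>0 < e\<close> C by (simp add: e'_def)
  from f[unfolded abs_cont_on_def, rule_format, OF this] obtain d1 where "0 < d1" and
    d1: "\<And>D. finite D \<and> (\<forall>(u, v)\<in>D. a \<le> u \<and> u \<le> v \<and> v \<le> b) \<and>
        pairwise (\<lambda>p q. disjnt {fst p<..<snd p} {fst q<..<snd q}) D \<and>
        (\<Sum>(u, v)\<in>D. v - u) < d1 \<Longrightarrow> (\<Sum>(u, v)\<in>D. norm (f v - f u)) < e'" by blast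
  from g[unfolded abs_cont_on_def, rule_format, OF \<open>0 < e'\<close>] obtain d2 where "0 < d2" and
    d2: "\<And>D. finite D \<and> (\<forall>(u, v)\<in>D. a \<le> u \<and> u \<le> v \<and> v \<le> b) \<and>
        pairwise (\<lambda>p q. disjnt {fst p<..<snd p} {fst q<..<snd q}) D \<and>
        (\<Sum>(u, v)\<in>D. v - u) < d2 \<Longrightarrow> (\<Sum>(u, v)\<in>D. norm (g v - g u)) < e'" by blast
  show "\<exists>\<delta>>0. \<forall>D. finite D \<and> (\<forall>(u, v)\<in>D. a \<le> u \<and> u \<le> v \<and> v \<le> b) \<and>
        pairwise (\<lambda>p q. disjnt {fst p<..<snd p} {fst q<..<snd q}) D \<and>
        (\<Sum>(u, v)\<in>D. v - u) < \<delta> \<longrightarrow> (\<Sum>(u, v)\<in>D. norm (h v - h u)) < e"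
  proof (intro exI[of _ "min d1 d2"] conjI allI impI)
    show "0 < min d1 d2" using \<open>0 < d1\<close> \<open>0 < d2\<close> by simp
    fix D :: "(real \<times> real) set"
    assume D: "finite D \<and> (\<forall>(u, v)\<in>D. a \<le> u \<and> u \<le> v \<and> v \<le> b) \<and>
        pairwise (\<lambda>p q. disjnt {fst p<..<snd p} {fst q<..<snd q}) D \<and>
        (\<Sum>(u, v)\<in>D. v - u) < min d1 d2"
    have "(\<Sum>(u, v)\<in>D. norm (h v - h u)) \<le> (\<Sum>(u, v)\<in>D. C * norm (f v - f u) + C * norm (g v - g u))"
    proof (rule sum_mono, clarify)
      fix u v assume "(u, v) \<in> D"
      then have "norm (h v - h u) \<le> A * norm (f v - f u) + B * norm (g v - g u)"
        using D by (intro h) auto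
      also have "\<dots> \<le> C * norm (f v - f u) + C * norm (g v - g u)"
        using C by (intro add_mono mult_right_mono) auto
      finally show "norm (h v - h u) \<le> C * norm (f v - f u) + C * norm (g v - g u)" .
    qed
    also have "\<dots> = C * (\<Sum>(u, v)\<in>D. norm (f v - f u)) + C * (\<Sum>(u, v)\<in>D. norm (g v - g u))"
      by (simp add: split_def sum.distrib sum_distrib_left)
    also have "\<dots> < C * e' + C * e'"
      using D C by (intro add_strict_mono mult_strict_left_mono d1 d2) auto
    also have "\<dots> = e" using C by (simp add: e'_def)
    finally show "(\<Sum>(u, v)\<in>D. norm (h v - h u)) < e" .
  qed
qed

text \<open>
  The identity turns \<open>abs_cont_on_dominated\<close> into a criterion for Lipschitz
  functions.
\<close>

lemma abs_cont_on_of_real: "abs_cont_on a b of_real"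
  unfolding abs_cont_on_def
proof (intro allI impI)
  fix e :: real assume "0 < e"
  have "(\<Sum>(u, v)\<in>D. norm (complex_of_real v - of_real u)) = (\<Sum>(u, v)\<in>D. v - u)"
    if "\<forall>(u, v)\<in>D. a \<le> u \<and> u \<le> v \<and> v \<le> b" for D
    using that by (intro sum.cong) (auto simp flip: of_real_diff)
  with \<open>0 < e\<close> show "\<exists>\<delta>>0. \<forall>D. finite D \<and> (\<forall>(u, v)\<in>D. a \<le> u \<and> u \<le> v \<and> v \<le> b) \<and>
        pairwise (\<lambda>p q. disjnt {fst p<..<snd p} {fst q<..<snd q}) D \<and>
        (\<Sum>(u, v)\<in>D. v - u) < \<delta> \<longrightarrow> (\<Sum>(u, v)\<in>D. norm (complex_of_real v - of_real u)) < e"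
    by (intro exI[of _ e]) auto
qed

lemma abs_cont_on_lipschitz:
  assumes "\<And>u v. a \<le> u \<Longrightarrow> u \<le> v \<Longrightarrow> v \<le> b \<Longrightarrow> norm (f v - f u) \<le> L * (v - u)"
  shows "abs_cont_on a b f"
  by (rule abs_cont_on_dominated[where A = L and B = 0, OF abs_cont_on_of_real abs_cont_on_of_real])
     (use assms in \<open>auto simp flip: of_real_diff\<close>)

lemma abs_cont_on_C1:
  fixes f :: "real \<Rightarrow> complex"
  assumes f: "\<And>x. x \<in> {a..b} \<Longrightarrow> (f has_vector_derivative f' x) (at x within {a..b})"
    and f': "continuous_on {a..b} f'"
  shows "abs_cont_on a b f"
proof -
  have "bounded (f' ` {a..b})" using f' by (intro compact_imp_bounded compact_continuous_image) auto
  then obtain L where L: "\<And>x. x \<in> {a..b} \<Longrightarrow> norm (f' x) \<le> L"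
    unfolding bounded_iff by blast
  show ?thesis
  proof (rule abs_cont_on_lipschitz[where L = L])
    fix u v assume uv: "a \<le> u" "u \<le> v" "v \<le> b"
    have "norm (f v - f u) \<le> L * norm (v - u)"
    proof (rule differentiable_bound[where S = "{a..b}" and f' = "\<lambda>x h. h *\<^sub>R f' x"])
      fix x assume x: "x \<in> {a..b}"
      show "(f has_derivative (\<lambda>h. h *\<^sub>R f' x)) (at x within {a..b})"
        using f[OF x] by (simp add: has_vector_derivative_def)
      show "onorm (\<lambda>h. h *\<^sub>R f' x) \<le> L"
        using L[OF x] by (intro onorm_le) (auto simp: mult.commute[of L] intro: mult_left_mono)
    qed (use uv in auto)
    then show "norm (f v - f u) \<le> L * (v - u)" using uv by simp
  qed
qed

lemma abs_cont_on_subinterval: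
  assumes "abs_cont_on a b f" "a \<le> c" "d \<le> b"
  shows "abs_cont_on c d f"
  unfolding abs_cont_on_def
proof (intro allI impI)
  fix e :: real assume "0 < e"
  from assms(1)[unfolded abs_cont_on_def, rule_format, OF this] obtain d1 where "0 < d1" and
    d1: "\<And>D. finite D \<and> (\<forall>(u, v)\<in>D. a \<le> u \<and> u \<le> v \<and> v \<le> b) \<and>
        pairwise (\<lambda>p q. disjnt {fst p<..<snd p} {fst q<..<snd q}) D \<and>
        (\<Sum>(u, v)\<in>D. v - u) < d1 \<Longrightarrow> (\<Sum>(u, v)\<in>D. norm (f v - f u)) < e" by blast
  show "\<exists>\<delta>>0. \<forall>D. finite D \<and> (\<forall>(u, v)\<in>D. c \<le> u \<and> u \<le> v \<and> v \<le> d) \<and>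
        pairwise (\<lambda>p q. disjnt {fst p<..<snd p} {fst q<..<snd q}) D \<and>
        (\<Sum>(u, v)\<in>D. v - u) < \<delta> \<longrightarrow> (\<Sum>(u, v)\<in>D. norm (f v - f u)) < e"
    using \<open>0 < d1\<close> assms(2,3) by (intro exI[of _ d1] conjI allI impI d1) fastforce+
qed

lemma abs_cont_on_imp_continuous_on:
  assumes "abs_cont_on a b f"
  shows "continuous_on {a..b} f"
  unfolding continuous_on_iff
proof (intro ballI allI impI)
  fix x e :: real assume x: "x \<in> {a..b}" and "0 < e"
  from assms[unfolded abs_cont_on_def, rule_format, OF this(2)] obtain d where "0 < d" and
    d: "\<And>D. finite D \<and> (\<forall>(u, v)\<in>D. a \<le> u \<and> u \<le> v \<and> v \<le> b) \<and>
        pairwise (\<lambda>p q. disjnt {fst p<..<snd p} {fst q<..<snd q}) D \<and>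
        (\<Sum>(u, v)\<in>D. v - u) < d \<Longrightarrow> (\<Sum>(u, v)\<in>D. norm (f v - f u)) < e" by blast
  have small: "norm (f v - f u) < e" if "a \<le> u" "u \<le> v" "v \<le> b" "v - u < d" for u v
    using d[of "{(u, v)}"] that by simp
  have "dist (f y) (f x) < e" if "y \<in> {a..b}" "dist y x < d" for y
    using small[of x y] small[of y x] x that
    by (cases "x \<le> y") (auto simp: dist_norm norm_minus_commute)
  with \<open>0 < d\<close> show "\<exists>d>0. \<forall>x'\<in>{a..b}. dist x' x < d \<longrightarrow> dist (f x') (f x) < e" by blast
qed

text \<open>
  On the compact interval both factors are bounded, and the product rule for increments then
  gives the domination.
\<close>

lemma abs_cont_on_mult:
  assumes f: "abs_cont_on a b f" and g: "abs_cont_on a b g"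
  shows "abs_cont_on a b (\<lambda>x. f x * g x)"
proof -
  have "bounded (f ` {a..b})" "bounded (g ` {a..b})"
    using f g by (auto intro!: compact_imp_bounded compact_continuous_image abs_cont_on_imp_continuous_on)
  then obtain A B where AB: "\<And>x. x \<in> {a..b} \<Longrightarrow> norm (f x) \<le> A" "\<And>x. x \<in> {a..b} \<Longrightarrow> norm (g x) \<le> B"
    unfolding bounded_iff by blast
  show ?thesis
  proof (rule abs_cont_on_dominated[OF f g])
    fix u v assume uv: "a \<le> u" "u \<le> v" "v \<le> b"
    have "norm (f v * g v - f u * g u) = norm (g v * (f v - f u) + f u * (g v - g u))"
      by (simp add: algebra_simps)
    also have "\<dots> \<le> norm (g v) * norm (f v - f u) + norm (f u) * norm (g v - g u)"
      by (metis norm_triangle_ineq norm_mult)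
    also have "\<dots> \<le> B * norm (f v - f u) + A * norm (g v - g u)"
      using AB uv by (intro add_mono mult_right_mono) auto
    finally show "norm (f v * g v - f u * g u) \<le> B * norm (f v - f u) + A * norm (g v - g u)" .
  qed
qed

lemma abs_cont_on_diff_mult:
  assumes "abs_cont_on a b f" "abs_cont_on a b g"
  shows "abs_cont_on a b (\<lambda>x. f x - c * g x)"
proof (rule abs_cont_on_dominated[OF assms])
  fix u v
  have "norm (f v - c * g v - (f u - c * g u)) = norm ((f v - f u) - c * (g v - g u))"
    by (simp add: algebra_simps)
  also have "\<dots> \<le> 1 * norm (f v - f u) + norm c * norm (g v - g u)"
    by (metis norm_triangle_ineq4 norm_mult mult_1)
  finally show "norm (f v - c * g v - (f u - c * g u)) \<le> 1 * norm (f v - f u) + norm c * norm (g v - g u)" .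
qed

lemma abs_cont_on_cong:
  assumes "abs_cont_on a b f" "\<And>x. x \<in> {a..b} \<Longrightarrow> g x = f x"
  shows "abs_cont_on a b g"
  by (rule abs_cont_on_dominated[where A = 1 and B = 0, OF assms(1) assms(1)]) (simp add: assms(2))

section \<open>The fundamental theorem of calculus\<close>

text \<open>
  Gauge integration produces divisions of a set, whereas absolute continuity speaks of sets
  of pairs. The members of a division are nonempty segments with disjoint interiors, so
  passing to the pair of end points loses nothing.
\<close>

lemma abs_cont_on_division:
  assumes F: "abs_cont_on a b F" and "0 < e"
  obtains d where "0 < d"
    "\<And>E S. E division_of S \<Longrightarrow> S \<subseteq> {a..b} \<Longrightarrow> measure lebesgue S < d \<Longrightarrow>
        (\<Sum>K\<in>E. norm (F (Sup K) - F (Inf K))) < e"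
proof -
  obtain d where "0 < d" and d: "\<And>D. finite D \<Longrightarrow> (\<forall>(u, v)\<in>D. a \<le> u \<and> u \<le> v \<and> v \<le> b) \<Longrightarrow>
      pairwise (\<lambda>p q. disjnt {fst p<..<snd p} {fst q<..<snd q}) D \<Longrightarrow>
      (\<Sum>(u, v)\<in>D. v - u) < d \<Longrightarrow> (\<Sum>(u, v)\<in>D. norm (F v - F u)) < e"
    using F \<open>0 < e\<close> unfolding abs_cont_on_def by meson
  have "(\<Sum>K\<in>E. norm (F (Sup K) - F (Inf K))) < e"
    if E: "E division_of S" and S: "S \<subseteq> {a..b}" and less: "measure lebesgue S < d" for E S
  proof -
    define ends :: "real set \<Rightarrow> real \<times> real" where "ends = (\<lambda>K. (Inf K, Sup K))"
    have K: "Inf K \<le> Sup K" "K = {Inf K..Sup K}" "Inf K \<in> K" "Sup K \<in> K" if KE: "K \<in> E" for K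
    proof -
      obtain u v where uv: "K = {u..v}" using division_ofD(4)[OF E KE] by auto
      moreover have "u \<le> v" using division_ofD(3)[OF E KE] uv by auto
      ultimately show "Inf K \<le> Sup K" "K = {Inf K..Sup K}" "Inf K \<in> K" "Sup K \<in> K" by auto
    qed
    have inj: "inj_on ends E"
      by (rule inj_onI) (metis K(2) ends_def prod.inject)
    have "(\<Sum>(u, v)\<in>ends ` E. norm (F v - F u)) < e"
    proof (rule d)
      show "finite (ends ` E)" using E by blast
      show "\<forall>(u, v)\<in>ends ` E. a \<le> u \<and> u \<le> v \<and> v \<le> b"
      proof clarify
        fix u v K assume uv: "(u, v) = ends K" and "K \<in> E"
        have "K \<subseteq> {a..b}" using division_ofD(2)[OF E \<open>K \<in> E\<close>] S by auto
        then show "a \<le> u \<and> u \<le> v \<and> v \<le> b" using K[OF \<open>K \<in> E\<close>] uv by (auto simp: ends_def)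
      qed
      show "pairwise (\<lambda>p q. disjnt {fst p<..<snd p} {fst q<..<snd q}) (ends ` E)"
      proof (rule pairwise_imageI)
        fix K L assume KL: "K \<in> E" "L \<in> E" "K \<noteq> L"
        then have "interior K \<inter> interior L = {}" using division_ofD(5)[OF E] by blast
        moreover have "interior K = {Inf K<..<Sup K}" "interior L = {Inf L<..<Sup L}"
          using K(2)[OF KL(1)] K(2)[OF KL(2)] by (metis interior_atLeastAtMost_real)+
        ultimately show "disjnt {fst (ends K)<..<snd (ends K)} {fst (ends L)<..<snd (ends L)}"
          by (simp add: disjnt_def ends_def)
      qed
      have "(\<Sum>(u, v)\<in>ends ` E. v - u) = (\<Sum>K\<in>E. Sup K - Inf K)"
        unfolding sum.reindex[OF inj] by (simp add: ends_def)
      also have "\<dots> = (\<Sum>K\<in>E. measure lebesgue K)"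
        by (rule sum.cong) (use K in \<open>metis measure_completion content_real sets.sets_into_space atLeastAtMost_borel sets_lborel\<close>)+
      also have "\<dots> < d" using content_division[OF E] less by simp
      finally show "(\<Sum>(u, v)\<in>ends ` E. v - u) < d" .
    qed
    then show ?thesis unfolding sum.reindex[OF inj] by (simp add: ends_def)
  qed
  with \<open>0 < d\<close> show thesis using that by blast
qed

text \<open>
  On an interval that contains the base point, the errors of the linear approximation to its
  left and to its right add up to at most \<open>e\<close> times the length.
\<close>

lemma straddle:
  fixes f :: "real \<Rightarrow> 'a::real_normed_vector"
  assumes vecd: "(f has_vector_derivative f') (at x within T)" and "0 < e"
  obtains d where "0 < d"
    "\<And>u v. u \<le> x \<Longrightarrow> x \<le> v \<Longrightarrow> u \<in> T \<Longrightarrow> v \<in> T \<Longrightarrow> {u, v} \<subseteq> ball x d \<Longrightarrow>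
        norm ((v - u) *\<^sub>R f' - (f v - f u)) \<le> e * (v - u)"
proof -
  obtain d where "0 < d" and d: "\<And>y. y \<in> T \<Longrightarrow> norm (y - x) < d \<Longrightarrow>
      norm (f y - f x - (y - x) *\<^sub>R f') \<le> e * norm (y - x)"
    using vecd \<open>0 < e\<close> unfolding has_vector_derivative_def has_derivative_within_alt by metis
  have "norm ((v - u) *\<^sub>R f' - (f v - f u)) \<le> e * (v - u)"
    if "u \<le> x" "x \<le> v" "u \<in> T" "v \<in> T" "{u, v} \<subseteq> ball x d" for u v
  proof -
    have "norm ((v - u) *\<^sub>R f' - (f v - f u))
        = norm ((f u - f x - (u - x) *\<^sub>R f') - (f v - f x - (v - x) *\<^sub>R f'))"
      by (auto simp: algebra_simps)
    also have "\<dots> \<le> norm (f u - f x - (u - x) *\<^sub>R f') + norm (f v - f x - (v - x) *\<^sub>R f')"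
      by (rule norm_triangle_ineq4)
    also have "\<dots> \<le> e * norm (u - x) + e * norm (v - x)"
      using that by (intro add_mono d) (auto simp: dist_real_def)
    also have "\<dots> = e * (v - u)" using that by (simp add: algebra_simps)
    finally show ?thesis .
  qed
  with \<open>0 < d\<close> show thesis using that by blast
qed

text \<open>
  In a gauge integral the tags can be treated according to their position. At tags outside
  \<open>N\<close> the straddle lemma compares each summand with an increment of
  \<open>F\<close>. At tags in \<open>N\<close> the integrand may be taken to be
  \<open>0\<close>, and the gauge confines the intervals to an open set of small measure
  containing \<open>N\<close>, on which absolute continuity makes the total increment of
  \<open>F\<close> small.
\<close>

lemma fundamental_theorem_of_calculus_abs_cont:
  assumes "a \<le> b" and F: "abs_cont_on a b F" and N: "negligible N"
    and F': "\<And>x. x \<in> {a..b} - N \<Longrightarrow> (F has_vector_derivative F' x) (at x within {a..b})"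
  shows "(F' has_integral (F b - F a)) {a..b}"
proof -
  define g where "g = (\<lambda>x. if x \<in> N then 0 else F' x)"
  have "(g has_integral (F b - F a)) {a..b}"
    unfolding has_integral_real
  proof (intro allI impI)
    fix e :: real assume "0 < e"
    \<comment> \<open>Tags outside \<open>N\<close> contribute at most \<open>e1 * (b - a)\<close>, which has to be at most \<open>e / 2\<close> even if \<open>a = b\<close>.\<close>
    define e1 where "e1 = e / (2 * (b - a + 1))"
    have "0 < e1" using \<open>0 < e\<close> \<open>a \<le> b\<close> by (simp add: e1_def)
    have e1: "e1 * (b - a) \<le> e / 2" using \<open>0 < e\<close> \<open>a \<le> b\<close> by (simp add: e1_def field_simps)
    obtain \<delta> where "0 < \<delta>" and \<delta>: "\<And>E S. E division_of S \<Longrightarrow> S \<subseteq> {a..b} \<Longrightarrow>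
        measure lebesgue S < \<delta> \<Longrightarrow> (\<Sum>K\<in>E. norm (F (Sup K) - F (Inf K))) < e / 2"
      using abs_cont_on_division[OF F, of "e / 2"] \<open>0 < e\<close> by auto
    obtain U where "open U" "N \<subseteq> U" and U: "U - N \<in> lmeasurable" "emeasure lebesgue (U - N) < \<delta>"
      using sets_lebesgue_outer_open[OF _ \<open>0 < \<delta>\<close>, of N] N negligible_imp_sets by metis
    have "U \<in> lmeasurable" "measure lebesgue U < \<delta>"
    proof -
      have Un: "U = (U - N) \<union> N" using \<open>N \<subseteq> U\<close> by blast
      show "U \<in> lmeasurable" using U(1) N Un by (metis fmeasurable.Un negligible_imp_measurable)
      have "measure lebesgue U = measure lebesgue (U - N)"
        using N \<open>U \<in> lmeasurable\<close> by (simp add: measure_Diff_null_set negligible_iff_null_sets fmeasurableD)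
      also have "\<dots> < \<delta>" using U by (simp add: emeasure_eq_measure2 ennreal_less_iff)
      finally show "measure lebesgue U < \<delta>" .
    qed
    have "\<exists>d>0. x \<in> {a..b} - N \<longrightarrow> (\<forall>u v. u \<le> x \<longrightarrow> x \<le> v \<longrightarrow> u \<in> {a..b} \<longrightarrow> v \<in> {a..b} \<longrightarrow>
        {u, v} \<subseteq> ball x d \<longrightarrow> norm ((v - u) *\<^sub>R F' x - (F v - F u)) \<le> e1 * (v - u))" for x
    proof (cases "x \<in> {a..b} - N")
      case True
      then show ?thesis using straddle[OF F'[OF True] \<open>0 < e1\<close>] by metis
    qed (auto intro: exI[of _ 1])
    then obtain d where dpos: "\<And>x. 0 < d x" and d: "\<And>x u v. x \<in> {a..b} - N \<Longrightarrow> u \<le> x \<Longrightarrow> x \<le> v \<Longrightarrow>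
        u \<in> {a..b} \<Longrightarrow> v \<in> {a..b} \<Longrightarrow> {u, v} \<subseteq> ball x (d x) \<Longrightarrow>
        norm ((v - u) *\<^sub>R F' x - (F v - F u)) \<le> e1 * (v - u)"
      by metis
    define \<gamma> where "\<gamma> = (\<lambda>x. if x \<in> N then U else ball x (d x))"
    have "gauge \<gamma>" using \<open>open U\<close> \<open>N \<subseteq> U\<close> dpos by (auto simp: gauge_def \<gamma>_def)
    moreover have "norm ((\<Sum>(x, K)\<in>p. measure lborel K *\<^sub>R g x) - (F b - F a)) < e"
      if p: "p tagged_division_of {a..b}" and fine: "\<gamma> fine p" for p
    proof -
      have finp: "finite p" using p by blast
      define bad where "bad = {(x, K) \<in> p. x \<in> N}"
      have bad: "bad \<subseteq> p" by (auto simp: bad_def)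
      have seg: "\<exists>u v. K = {u..v} \<and> u \<le> x \<and> x \<le> v \<and> a \<le> u \<and> v \<le> b" if xK: "(x, K) \<in> p" for x K
      proof -
        have "x \<in> K" "K \<subseteq> {a..b}" using tagged_division_ofD(2,3)[OF p xK] by auto
        moreover obtain u v where "K = {u..v}" using tagged_division_ofD(4)[OF p xK] by auto
        ultimately show ?thesis by auto
      qed
      let ?D = "\<lambda>K. F (Sup K) - F (Inf K)"
      have sums: "(\<Sum>(x, K)\<in>p. ?D K) = F b - F a" "(\<Sum>(x, K)\<in>p. Sup K - Inf K) = b - a"
        using additive_tagged_division_1[OF \<open>a \<le> b\<close> p, of F]
          additive_tagged_division_1[OF \<open>a \<le> b\<close> p, of "\<lambda>x. x"] by auto
      have "norm ((\<Sum>(x, K)\<in>p. measure lborel K *\<^sub>R g x) - (F b - F a))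
          = norm (\<Sum>(x, K)\<in>p. measure lborel K *\<^sub>R g x - ?D K)"
        by (simp add: sums(1)[symmetric] split_def sum_subtractf)
      also have "\<dots> \<le> (\<Sum>(x, K)\<in>p. norm (measure lborel K *\<^sub>R g x - ?D K))"
        unfolding split_def by (rule norm_sum)
      also have "\<dots> = (\<Sum>(x, K)\<in>p - bad. norm (measure lborel K *\<^sub>R g x - ?D K))
          + (\<Sum>(x, K)\<in>bad. norm (measure lborel K *\<^sub>R g x - ?D K))"
        by (rule sum.subset_diff[OF bad finp])
      also have "(\<Sum>(x, K)\<in>p - bad. norm (measure lborel K *\<^sub>R g x - ?D K)) \<le> (\<Sum>(x, K)\<in>p - bad. e1 * (Sup K - Inf K))"
      proof (rule sum_mono, clarify)
        fix x K assume xK: "(x, K) \<in> p" "(x, K) \<notin> bad"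
        then have "x \<notin> N" by (auto simp: bad_def)
        obtain u v where uv: "K = {u..v}" "u \<le> x" "x \<le> v" "a \<le> u" "v \<le> b" using seg[OF xK(1)] by blast
        have "K \<subseteq> ball x (d x)" using fineD[OF fine xK(1)] \<open>x \<notin> N\<close> by (simp add: \<gamma>_def)
        moreover have "{u, v} \<subseteq> K" using uv by auto
        ultimately have "{u, v} \<subseteq> ball x (d x)" by blast
        then have "norm ((v - u) *\<^sub>R F' x - (F v - F u)) \<le> e1 * (v - u)"
          using uv \<open>x \<notin> N\<close> by (intro d) auto
        then show "norm (measure lborel K *\<^sub>R g x - ?D K) \<le> e1 * (Sup K - Inf K)"
          using uv \<open>x \<notin> N\<close> by (simp add: g_def)
      qed
      also have "\<dots> \<le> (\<Sum>(x, K)\<in>p. e1 * (Sup K - Inf K))"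
      proof (rule sum_mono2[OF finp])
        fix q assume "q \<in> p - (p - bad)"
        then obtain x K where "q = (x, K)" "(x, K) \<in> p" by (cases q) auto
        then show "0 \<le> (case q of (x, K) \<Rightarrow> e1 * (Sup K - Inf K))"
          using seg[of x K] \<open>0 < e1\<close> by auto
      qed auto
      also have "\<dots> = e1 * (b - a)"
        by (simp add: sums(2)[symmetric] split_def sum_distrib_left)
      also have "\<dots> \<le> e / 2" by (rule e1)
      also have "(\<Sum>(x, K)\<in>bad. norm (measure lborel K *\<^sub>R g x - ?D K)) < e / 2"
      proof -
        have part: "bad tagged_partial_division_of {a..b}"
          using tagged_partial_division_subset[OF _ bad] p by (auto simp: tagged_division_of_def)
        \<comment> \<open>The empty set needs a value of its own because \<open>Inf {}\<close> and \<open>Sup {}\<close> are unspecified reals.\<close>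
        define D where "D K = (if K = {} then 0 else norm (?D K))" for K
        have "(\<Sum>(x, K)\<in>bad. norm (measure lborel K *\<^sub>R g x - ?D K)) = (\<Sum>(x, K)\<in>bad. D K)"
        proof (rule sum.cong[OF refl], clarify)
          fix x K assume "(x, K) \<in> bad"
          moreover from this have "x \<in> K" using tagged_division_ofD(2)[OF p] bad by blast
          ultimately show "norm (measure lborel K *\<^sub>R g x - ?D K) = D K"
            by (auto simp: bad_def g_def D_def norm_minus_commute)
        qed
        also have "\<dots> = (\<Sum>K\<in>snd ` bad. D K)"
          by (rule sum.over_tagged_division_lemma[OF tagged_partial_division_of_Union_self[OF part]])
             (auto simp: D_def box_eq_empty)
        also have "\<dots> \<le> (\<Sum>K\<in>snd ` bad. norm (?D K))"
          by (rule sum_mono) (simp add: D_def)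
        also have "\<dots> < e / 2"
        proof (rule \<delta>)
          show div: "(snd ` bad) division_of \<Union>(snd ` bad)" by (rule partial_division_of_tagged_division[OF part])
          show "\<Union>(snd ` bad) \<subseteq> {a..b}" using tagged_partial_division_ofD(3)[OF part] by fastforce
          have "\<Union>(snd ` bad) \<subseteq> U" using fine by (fastforce simp: bad_def fine_def \<gamma>_def)
          then have "measure lebesgue (\<Union>(snd ` bad)) \<le> measure lebesgue U"
            using \<open>U \<in> lmeasurable\<close> lmeasurable_division[OF div] by (intro measure_mono_fmeasurable) auto
          then show "measure lebesgue (\<Union>(snd ` bad)) < \<delta>" using \<open>measure lebesgue U < \<delta>\<close> by simp
        qed
        finally show ?thesis .
      qed
      finally show ?thesis by simp
    qed
    ultimately show "\<exists>\<gamma>. gauge \<gamma> \<and> (\<forall>p. p tagged_division_of {a..b} \<and> \<gamma> fine p \<longrightarrow>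
        norm ((\<Sum>(x, K)\<in>p. measure lborel K *\<^sub>R g x) - (F b - F a)) < e)"
      by (intro exI[of _ \<gamma>]) auto
  qed
  then show ?thesis by (rule has_integral_spike[OF N, rotated]) (auto simp: g_def)
qed

lemma abs_cont_on_integral_deriv:
  assumes "a \<le> b" and "abs_cont_on a b F" and "negligible N"
    and "\<And>x. x \<in> {a..b} - N \<Longrightarrow> (F has_vector_derivative F' x) (at x within {a..b})"
    and "set_integrable lebesgue {a..b} F'"
  shows "(LINT x:{a..b}|lebesgue. F' x) = F b - F a"
  using has_integral_set_lebesgue[OF assms(5)] fundamental_theorem_of_calculus_abs_cont[OF assms(1-4)]
  by (rule has_integral_unique)

text \<open>
  The fundamental theorem is applied with the constant \<open>0\<close> itself as the
  derivative, on each initial segment of the interval.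
\<close>

lemma abs_cont_on_deriv_zero:
  assumes F: "abs_cont_on a b F" and N: "negligible N"
    and F': "\<And>x. x \<in> {a..b} - N \<Longrightarrow> (F has_vector_derivative 0) (at x within {a..b})"
    and x: "x \<in> {a..b}"
  shows "F x = F a"
proof -
  have "((\<lambda>_. 0) has_integral (F x - F a)) {a..x}"
  proof (rule fundamental_theorem_of_calculus_abs_cont[where F = F and N = N])
    show "abs_cont_on a x F" using abs_cont_on_subinterval[OF F, of a x] x by simp
    fix y assume "y \<in> {a..x} - N"
    then have "y \<in> {a..b} - N" using x by simp
    from has_vector_derivative_within_subset[OF F'[OF this], of "{a..x}"]
    show "(F has_vector_derivative 0) (at y within {a..x})" using x by simp
  qed (use x N in simp_all)
  from has_integral_unique[OF this has_integral_0] show ?thesis by simp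
qed

section \<open>Square-integrable functions\<close>

lemma L2_01_cong:
  assumes "L2_01 f" "\<And>x. x \<in> {0..1} \<Longrightarrow> g x = f x"
  shows "L2_01 g"
proof -
  have "(\<lambda>x. indicator {0..1} x *\<^sub>R g x) = (\<lambda>x::real. indicator {0..1} x *\<^sub>R f x)"
    "(\<lambda>x. indicator {0..1} x *\<^sub>R (norm (g x))\<^sup>2) = (\<lambda>x::real. indicator {0..1} x *\<^sub>R (norm (f x))\<^sup>2)"
    using assms(2) by (auto simp: fun_eq_iff indicator_def)
  with assms(1) show ?thesis
    by (simp add: L2_01_def set_borel_measurable_def set_integrable_def)
qed

lemma set_borel_measurable_mult:
  fixes f g :: "'a \<Rightarrow> complex"
  assumes "set_borel_measurable M A f" "set_borel_measurable M A g"
  shows "set_borel_measurable M A (\<lambda>x. f x * g x)"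
proof -
  have eq: "(\<lambda>x. indicator A x *\<^sub>R (f x * g x)) = (\<lambda>x. (indicator A x *\<^sub>R f x) * (indicator A x *\<^sub>R g x))"
    by (auto simp: fun_eq_iff indicator_def)
  show ?thesis using assms unfolding set_borel_measurable_def eq
    by (intro borel_measurable_times)
qed

lemma set_borel_measurable_diff_mult:
  fixes f g :: "'a \<Rightarrow> complex"
  assumes "set_borel_measurable M A f" "set_borel_measurable M A g"
  shows "set_borel_measurable M A (\<lambda>x. f x - c * g x)"
proof -
  have eq: "(\<lambda>x. indicator A x *\<^sub>R (f x - c * g x)) = (\<lambda>x. (indicator A x *\<^sub>R f x) - c * (indicator A x *\<^sub>R g x))"
    by (auto simp: fun_eq_iff indicator_def)
  show ?thesis using assms unfolding set_borel_measurable_def eq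
    by (intro borel_measurable_diff borel_measurable_times borel_measurable_const)
qed

lemma set_borel_measurable_norm_sq:
  fixes f :: "'a \<Rightarrow> complex"
  assumes "set_borel_measurable M A f"
  shows "set_borel_measurable M A (\<lambda>x. (norm (f x))\<^sup>2)"
proof -
  have eq: "(\<lambda>x. indicator A x *\<^sub>R (norm (f x))\<^sup>2) = (\<lambda>x. (norm (indicator A x *\<^sub>R f x))\<^sup>2)"
    by (auto simp: fun_eq_iff indicator_def)
  show ?thesis using assms unfolding set_borel_measurable_def eq
    by (intro borel_measurable_power measurable_compose[OF _ borel_measurable_norm])
qed

lemma set_integrable_imp_measurable:
  "set_integrable M A f \<Longrightarrow> set_borel_measurable M A f"
  by (auto simp: set_integrable_def set_borel_measurable_def)

lemma L2_01_continuous: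
  assumes "continuous_on {0..1} g"
  shows "L2_01 g"
  unfolding L2_01_def
  using assms by (auto intro!: set_integrable_imp_measurable absolutely_integrable_continuous_real continuous_intros)

lemma L2_01_cnj:
  assumes "L2_01 g"
  shows "L2_01 (\<lambda>x. cnj (g x))"
proof -
  have eq: "(\<lambda>x. indicator {0..1::real} x *\<^sub>R cnj (g x)) = (\<lambda>x. cnj (indicator {0..1} x *\<^sub>R g x))"
    by (auto simp: fun_eq_iff indicator_def)
  have "cnj \<in> borel_measurable borel"
    by (intro borel_measurable_continuous_onI continuous_intros)
  from measurable_compose[OF _ this] have "set_borel_measurable lebesgue {0..1} (\<lambda>x. cnj (g x))"
    using assms unfolding L2_01_def set_borel_measurable_def eq by blast
  with assms show ?thesis by (simp add: L2_01_def)
qed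

text \<open>
  The product is dominated by \<open>\<bar>f\<bar>\<^sup>2 + \<bar>g\<bar>\<^sup>2\<close>.
\<close>

lemma L2_01_mult_integrable:
  assumes f: "L2_01 f" and g: "L2_01 g"
  shows "set_integrable lebesgue {0..1} (\<lambda>x. f x * g x)"
proof (rule set_integrable_bound)
  show "set_integrable lebesgue {0..1} (\<lambda>x. (norm (f x))\<^sup>2 + (norm (g x))\<^sup>2)"
    using f g by (auto simp: L2_01_def)
  show "set_borel_measurable lebesgue {0..1} (\<lambda>x. f x * g x)"
    using f g by (auto simp: L2_01_def intro: set_borel_measurable_mult)
  have "norm (f x * g x) \<le> (norm (f x))\<^sup>2 + (norm (g x))\<^sup>2" for x
  proof -
    have "0 \<le> norm (f x) * norm (g x)" by simp
    moreover have "2 * (norm (f x) * norm (g x)) \<le> (norm (f x))\<^sup>2 + (norm (g x))\<^sup>2"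
      using sum_squares_bound[of "norm (f x)" "norm (g x)"] by (simp add: mult.assoc)
    ultimately show ?thesis unfolding norm_mult by linarith
  qed
  then show "AE x in lebesgue. x \<in> {0..1} \<longrightarrow> norm (f x * g x) \<le> norm ((norm (f x))\<^sup>2 + (norm (g x))\<^sup>2)"
    by simp
qed

lemma L2_01_integrable:
  assumes "L2_01 f"
  shows "set_integrable lebesgue {0..1} f"
  using L2_01_mult_integrable[OF assms L2_01_continuous[of "\<lambda>_. 1"]] by simp

lemma L2_01_diff_mult:
  assumes f: "L2_01 f" and g: "L2_01 g"
  shows "L2_01 (\<lambda>x. f x - c * g x)"
  unfolding L2_01_def
proof
  show meas: "set_borel_measurable lebesgue {0..1} (\<lambda>x. f x - c * g x)"
    using f g by (auto simp: L2_01_def intro: set_borel_measurable_diff_mult)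
  have bound: "(norm (f x - c * g x))\<^sup>2 \<le> 2 * (norm (f x))\<^sup>2 + 2 * (norm c)\<^sup>2 * (norm (g x))\<^sup>2" for x
  proof -
    have "(norm (f x - c * g x))\<^sup>2 \<le> (norm (f x) + norm c * norm (g x))\<^sup>2"
      by (intro power_mono) (metis norm_triangle_ineq4 norm_mult, simp)
    also have "\<dots> \<le> 2 * (norm (f x))\<^sup>2 + 2 * (norm c)\<^sup>2 * (norm (g x))\<^sup>2"
      using sum_squares_bound[of "norm (f x)" "norm c * norm (g x)"]
      by (simp add: power2_sum power_mult_distrib)
    finally show ?thesis .
  qed
  show "set_integrable lebesgue {0..1} (\<lambda>x. (norm (f x - c * g x))\<^sup>2)"
  proof (rule set_integrable_bound)
    show "set_integrable lebesgue {0..1} (\<lambda>x. 2 * (norm (f x))\<^sup>2 + 2 * (norm c)\<^sup>2 * (norm (g x))\<^sup>2)"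
      using f g by (auto simp: L2_01_def)
    show "set_borel_measurable lebesgue {0..1} (\<lambda>x. (norm (f x - c * g x))\<^sup>2)"
      by (rule set_borel_measurable_norm_sq[OF meas])
    show "AE x in lebesgue. x \<in> {0..1} \<longrightarrow> norm ((norm (f x - c * g x))\<^sup>2)
        \<le> norm (2 * (norm (f x))\<^sup>2 + 2 * (norm c)\<^sup>2 * (norm (g x))\<^sup>2)"
      using bound by simp
  qed
qed

text \<open>
  Lebesgue measure is complete, so changing \<open>f\<close> on a null set preserves
  measurability.
\<close>

lemma L2_01_cong_AE:
  assumes f: "L2_01 f" and ae: "AE x\<in>{0..1} in lebesgue. f x = g x"
  shows "L2_01 g"
  unfolding L2_01_def
proof
  have "(\<lambda>x. indicator {0..1} x *\<^sub>R f x) \<in> borel_measurable lebesgue"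
    using f by (simp add: L2_01_def set_borel_measurable_def)
  moreover have "AE x in lebesgue. indicator {0..1::real} x *\<^sub>R f x = indicator {0..1} x *\<^sub>R g x"
    using ae by eventually_elim (auto simp: indicator_def)
  ultimately show meas: "set_borel_measurable lebesgue {0..1} g"
    unfolding set_borel_measurable_def by (rule borel_measurable_AE)
  show "set_integrable lebesgue {0..1} (\<lambda>x. (norm (g x))\<^sup>2)"
  proof (rule set_integrable_bound)
    show "set_integrable lebesgue {0..1} (\<lambda>x. (norm (f x))\<^sup>2)" using f by (simp add: L2_01_def)
    show "AE x in lebesgue. x \<in> {0..1} \<longrightarrow> norm ((norm (g x))\<^sup>2) \<le> norm ((norm (f x))\<^sup>2)"
      using ae by eventually_elim simp
  qed (rule set_borel_measurable_norm_sq[OF meas])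
qed

lemma set_lebesgue_integral_AE_eq:
  fixes f g :: "real \<Rightarrow> complex"
  assumes "AE x\<in>{0..1} in lebesgue. f x = g x" "set_borel_measurable lebesgue {0..1} f"
  shows "(LINT x:{0..1}|lebesgue. f x) = (LINT x:{0..1}|lebesgue. g x)"
proof -
  have ae: "AE x in lebesgue. indicator {0..1} x *\<^sub>R f x = indicator {0..1} x *\<^sub>R g x"
    using assms(1) by eventually_elim (auto simp: indicator_def)
  then show ?thesis
    unfolding set_lebesgue_integral_def
    using assms(2) borel_measurable_AE[OF _ ae]
    by (intro integral_cong_AE) (auto simp: set_borel_measurable_def)
qed

lemma set_integral_cnj:
  "(LINT x:A|M. cnj (f x)) = cnj (LINT x:A|M. f x)"
proof -
  have eq: "(\<lambda>x. indicator A x *\<^sub>R cnj (f x)) = (\<lambda>x. cnj (indicator A x *\<^sub>R f x))"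
    by (auto simp: fun_eq_iff indicator_def)
  show ?thesis unfolding set_lebesgue_integral_def eq by (rule Bochner_Integration.integral_cnj)
qed

section \<open>Iterated derivatives and Sobolev functions\<close>

lemma deriv01_0 [simp]: "deriv01 0 f = f"
  by (simp add: deriv01_def)

lemma deriv01_Suc: "deriv01 (Suc l) f = (\<lambda>x. vector_derivative (deriv01 l f) (at x within {0..1}))"
  by (simp add: deriv01_def)

text \<open>
  The derivatives are taken within \<open>[0,1]\<close>, hence values outside the interval
  cannot influence them.
\<close>

lemma deriv01_cong:
  assumes "\<And>x. x \<in> {0..1} \<Longrightarrow> g x = f x" and "x \<in> {0..1}"
  shows "deriv01 l g x = deriv01 l f x"
  using assms(2)
proof (induction l arbitrary: x)
  case (Suc l)
  have "(deriv01 l g has_vector_derivative D) (at x within {0..1})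
      \<longleftrightarrow> (deriv01 l f has_vector_derivative D) (at x within {0..1})" for D
    using has_vector_derivative_transform[OF Suc.prems] Suc.IH by metis
  then show ?case by (simp add: deriv01_Suc vector_derivative_def)
qed (use assms in simp)

lemma has_vector_derivative_deriv01:
  assumes "deriv01 l f differentiable (at x within {0..1})"
  shows "(deriv01 l f has_vector_derivative deriv01 (Suc l) f x) (at x within {0..1})"
  using assms by (simp add: deriv01_Suc vector_derivative_works)

lemma deriv01_SucI:
  assumes "(deriv01 l f has_vector_derivative D) (at x within {0..1})" "x \<in> {0..1}"
  shows "deriv01 (Suc l) f x = D"
  using vector_derivative_within_cbox[of 0 1 x "deriv01 l f" D] assms by (simp add: deriv01_Suc)

lemma sobolevI:
  assumes diff: "\<And>l x. l < s - 1 \<Longrightarrow> x \<in> {0..1} \<Longrightarrow> deriv01 l f differentiable (at x within {0..1})"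
    and "abs_cont_on 0 1 (deriv01 (s - 1) f)"
    and "AE x\<in>{0..1} in lebesgue. deriv01 (s - 1) f differentiable (at x within {0..1})"
    and "L2_01 (deriv01 s f)"
  shows "f \<in> sobolev s"
  using assms by (simp add: sobolev_def)

lemma sobolev_differentiable:
  "f \<in> sobolev s \<Longrightarrow> l < s - 1 \<Longrightarrow> x \<in> {0..1} \<Longrightarrow> deriv01 l f differentiable (at x within {0..1})"
  by (simp add: sobolev_def)

text \<open>
  Absolute continuity is part of the definition only at order \<open>s - 1\<close>; the
  lower derivatives are continuously differentiable on a compact interval and therefore
  Lipschitz.
\<close>

lemma sobolev_abs_cont:
  assumes f: "f \<in> sobolev s" and l: "l < s"
  shows "abs_cont_on 0 1 (deriv01 l f)"
proof (cases "l = s - 1")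
  case True
  then show ?thesis using f by (simp add: sobolev_def)
next
  case False
  with l have l: "l < s - 1" by simp
  have diff: "\<And>l x. l < s - 1 \<Longrightarrow> x \<in> {0..1} \<Longrightarrow> deriv01 l f differentiable (at x within {0..1})"
    using f by (simp add: sobolev_def)
  have "continuous_on {0..1} (deriv01 (Suc l) f)"
  proof (cases "Suc l = s - 1")
    case True
    then show ?thesis using f by (auto simp: sobolev_def intro: abs_cont_on_imp_continuous_on)
  next
    case False
    then show ?thesis using l diff
      by (intro differentiable_imp_continuous_on) (auto simp: differentiable_on_def)
  qed
  then show ?thesis
    by (rule abs_cont_on_C1[rotated]) (rule has_vector_derivative_deriv01[OF diff[OF l]])
qed

text \<open>
  A uniform description of all derivatives up to the top order: the exceptional set is empty
  except at order \<open>s - 1\<close>.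
\<close>

lemma sobolev_deriv:
  assumes f: "f \<in> sobolev s" and l: "l < s"
  obtains N where "negligible N"
    "\<And>x. x \<in> {0..1} - N \<Longrightarrow> (deriv01 l f has_vector_derivative deriv01 (Suc l) f x) (at x within {0..1})"
proof (cases "l = s - 1")
  case True
  then have "AE x in lebesgue. x \<in> {0..1} \<longrightarrow> deriv01 l f differentiable (at x within {0..1})"
    using f by (simp add: sobolev_def)
  then obtain N where N: "negligible N"
    "{x. \<not> (x \<in> {0..1} \<longrightarrow> deriv01 l f differentiable (at x within {0..1}))} \<subseteq> N"
    unfolding eventually_ae_filter_negligible by blast
  show thesis
    by (rule that[OF N(1) has_vector_derivative_deriv01]) (use N(2) in blast)
next
  case False
  with l have "l < s - 1" by simp
  show thesis
    by (rule that[OF negligible_empty has_vector_derivative_deriv01[OF sobolev_differentiable[OF f \<open>l < s - 1\<close>]]]) simp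
qed

lemma sobolev_L2:
  assumes "f \<in> sobolev s" "l \<le> s"
  shows "L2_01 (deriv01 l f)"
proof (cases "l = s")
  case True
  then show ?thesis using assms by (simp add: sobolev_def)
next
  case False
  then show ?thesis using assms
    by (intro L2_01_continuous abs_cont_on_imp_continuous_on sobolev_abs_cont[of f s]) auto
qed

lemma sobolev_integrable:
  assumes "f \<in> sobolev s" "l \<le> s"
  shows "set_integrable lebesgue {0..1} (deriv01 l f)"
  by (rule L2_01_integrable[OF sobolev_L2[OF assms]])

lemma differentiable_at_cong:
  assumes "f differentiable (at x within S)" "x \<in> S" "\<And>y. y \<in> S \<Longrightarrow> g y = f y"
  shows "g differentiable (at x within S)"
  by (rule differentiable_transform_within[OF assms(1) zero_less_one assms(2)]) (simp add: assms(3))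

lemma sobolev_cong:
  assumes f: "f \<in> sobolev s" and eq: "\<And>x. x \<in> {0..1} \<Longrightarrow> g x = f x"
  shows "g \<in> sobolev s"
proof (rule sobolevI)
  have d: "deriv01 l g x = deriv01 l f x" if "x \<in> {0..1}" for l x
    using deriv01_cong[OF eq that] .
  show "deriv01 l g differentiable (at x within {0..1})" if "l < s - 1" "x \<in> {0..1}" for l x
    using differentiable_at_cong[of "deriv01 l f" x "{0..1}" "deriv01 l g"] d that f
    by (auto simp: sobolev_def)
  show "abs_cont_on 0 1 (deriv01 (s - 1) g)"
    using f d by (auto simp: sobolev_def intro: abs_cont_on_cong)
  have "AE x\<in>{0..1} in lebesgue. deriv01 (s - 1) f differentiable (at x within {0..1})"
    using f by (simp add: sobolev_def)
  then show "AE x\<in>{0..1} in lebesgue. deriv01 (s - 1) g differentiable (at x within {0..1})"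
    by eventually_elim (use d differentiable_at_cong in blast)
  show "L2_01 (deriv01 s g)"
    using f d by (auto simp: sobolev_def intro: L2_01_cong)
qed

lemma periodic_sobolev_cong:
  assumes "f \<in> periodic_sobolev s" "\<And>x. x \<in> {0..1} \<Longrightarrow> g x = f x"
  shows "g \<in> periodic_sobolev s"
  using assms sobolev_cong[of f s g] deriv01_cong[of g f]
  by (auto simp: periodic_sobolev_def)

lemma sobolev_inner_cong:
  assumes "\<And>x. x \<in> {0..1} \<Longrightarrow> f x = f' x" "\<And>x. x \<in> {0..1} \<Longrightarrow> g x = g' x"
  shows "sobolev_inner s f g = sobolev_inner s f' g'"
proof -
  have *: "(LINT x:{0..1}|lebesgue. u x) = (LINT x:{0..1}|lebesgue. v x)"
    if "\<And>x. x \<in> {0..1} \<Longrightarrow> u x = v x" for u v :: "real \<Rightarrow> complex"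
    by (rule set_lebesgue_integral_cong) (auto simp: that)
  have f: "deriv01 l f x = deriv01 l f' x" and g: "deriv01 l g x = deriv01 l g' x" if "x \<in> {0..1}" for l x
    by (rule deriv01_cong[OF assms(1) that], assumption) (rule deriv01_cong[OF assms(2) that])
  have "(LINT x:{0..1}|lebesgue. deriv01 l f x) = (LINT x:{0..1}|lebesgue. deriv01 l f' x)"
    "(LINT x:{0..1}|lebesgue. cnj (deriv01 l g x)) = (LINT x:{0..1}|lebesgue. cnj (deriv01 l g' x))"
    "(LINT x:{0..1}|lebesgue. deriv01 l f x * cnj (deriv01 l g x))
      = (LINT x:{0..1}|lebesgue. deriv01 l f' x * cnj (deriv01 l g' x))" for l
    by (rule *, simp only: f g)+
  then show ?thesis by (simp only: sobolev_inner_def)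
qed

text \<open>
  Linearity passes from order \<open>l\<close> to order \<open>Suc l\<close> at every point
  where both derivatives exist. Below the top order this is every point of
  \<open>[0,1]\<close>, at the top order almost every one.
\<close>

lemma deriv01_diff_mult_step:
  assumes h: "\<And>y. y \<in> {0..1} \<Longrightarrow> deriv01 l h y = deriv01 l f y - c * deriv01 l g y" and x: "x \<in> {0..1}"
    and f: "(deriv01 l f has_vector_derivative deriv01 (Suc l) f x) (at x within {0..1})"
    and g: "(deriv01 l g has_vector_derivative deriv01 (Suc l) g x) (at x within {0..1})"
  shows "deriv01 l h differentiable (at x within {0..1})"
    and "deriv01 (Suc l) h x = deriv01 (Suc l) f x - c * deriv01 (Suc l) g x"
proof -
  have "((\<lambda>y. deriv01 l f y - c * deriv01 l g y) has_vector_derivative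
      deriv01 (Suc l) f x - c * deriv01 (Suc l) g x) (at x within {0..1})"
    by (intro has_vector_derivative_diff has_vector_derivative_mult_right f g)
  from has_vector_derivative_transform[OF x h this] have D: "(deriv01 l h has_vector_derivative
      deriv01 (Suc l) f x - c * deriv01 (Suc l) g x) (at x within {0..1})"
    .
  then show "deriv01 l h differentiable (at x within {0..1})"
    by (auto simp: has_vector_derivative_def differentiable_def)
  show "deriv01 (Suc l) h x = deriv01 (Suc l) f x - c * deriv01 (Suc l) g x"
    by (rule deriv01_SucI[OF D x])
qed

lemma deriv01_diff_mult:
  assumes f: "f \<in> sobolev s" and g: "g \<in> sobolev s" and "l < s" and "x \<in> {0..1}"
  shows "deriv01 l (\<lambda>x. f x - c * g x) x = deriv01 l f x - c * deriv01 l g x"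
  using assms(3,4)
proof (induction l arbitrary: x)
  case (Suc l)
  then have "l < s - 1" "l < s" by simp_all
  show ?case
  proof (rule deriv01_diff_mult_step(2)[OF Suc.IH[OF \<open>l < s\<close>] Suc.prems(2)])
    show "(deriv01 l f has_vector_derivative deriv01 (Suc l) f x) (at x within {0..1})"
      "(deriv01 l g has_vector_derivative deriv01 (Suc l) g x) (at x within {0..1})"
      using sobolev_differentiable[OF _ \<open>l < s - 1\<close> Suc.prems(2)] f g
      by (auto intro!: has_vector_derivative_deriv01)
  qed
qed simp

lemma deriv01_diff_mult_top:
  assumes f: "f \<in> sobolev s" and g: "g \<in> sobolev s" and s: "s \<ge> 1"
  shows "AE x\<in>{0..1} in lebesgue. deriv01 (s - 1) (\<lambda>x. f x - c * g x) differentiable (at x within {0..1}) \<and>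
      deriv01 s (\<lambda>x. f x - c * g x) x = deriv01 s f x - c * deriv01 s g x"
proof -
  have "AE x\<in>{0..1} in lebesgue. deriv01 (s - 1) f differentiable (at x within {0..1})"
    "AE x\<in>{0..1} in lebesgue. deriv01 (s - 1) g differentiable (at x within {0..1})"
    using f g by (auto simp: sobolev_def)
  then show ?thesis
  proof eventually_elim
    case (elim x)
    show ?case
    proof
      assume x: "x \<in> {0..1}"
      have "(deriv01 (s - 1) f has_vector_derivative deriv01 (Suc (s - 1)) f x) (at x within {0..1})"
        "(deriv01 (s - 1) g has_vector_derivative deriv01 (Suc (s - 1)) g x) (at x within {0..1})"
        using elim x by (auto intro!: has_vector_derivative_deriv01)
      from deriv01_diff_mult_step[OF deriv01_diff_mult[OF f g] x this] s
      show "deriv01 (s - 1) (\<lambda>x. f x - c * g x) differentiable (at x within {0..1}) \<and>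
          deriv01 s (\<lambda>x. f x - c * g x) x = deriv01 s f x - c * deriv01 s g x" by simp
    qed
  qed
qed

lemma sobolev_diff_mult:
  assumes f: "f \<in> sobolev s" and g: "g \<in> sobolev s" and s: "s \<ge> 1"
  shows "(\<lambda>x. f x - c * g x) \<in> sobolev s"
proof (rule sobolevI)
  show "deriv01 l (\<lambda>x. f x - c * g x) differentiable (at x within {0..1})" if "l < s - 1" "x \<in> {0..1}" for l x
  proof (rule deriv01_diff_mult_step(1)[where f = f and g = g and c = c])
    show "deriv01 l (\<lambda>x. f x - c * g x) y = deriv01 l f y - c * deriv01 l g y" if "y \<in> {0..1}" for y
      using deriv01_diff_mult[OF f g _ that] \<open>l < s - 1\<close> by simp
  qed (use that has_vector_derivative_deriv01 sobolev_differentiable f g in blast)+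
  show "abs_cont_on 0 1 (deriv01 (s - 1) (\<lambda>x. f x - c * g x))"
  proof (rule abs_cont_on_cong)
    show "abs_cont_on 0 1 (\<lambda>x. deriv01 (s - 1) f x - c * deriv01 (s - 1) g x)"
      using s by (intro abs_cont_on_diff_mult sobolev_abs_cont[OF f] sobolev_abs_cont[OF g]) simp_all
    show "deriv01 (s - 1) (\<lambda>x. f x - c * g x) x = deriv01 (s - 1) f x - c * deriv01 (s - 1) g x"
      if "x \<in> {0..1}" for x
      using deriv01_diff_mult[OF f g _ that] s by simp
  qed
  show "AE x\<in>{0..1} in lebesgue. deriv01 (s - 1) (\<lambda>x. f x - c * g x) differentiable (at x within {0..1})"
    using deriv01_diff_mult_top[OF assms, of c] by eventually_elim auto
  have "AE x\<in>{0..1} in lebesgue. deriv01 s f x - c * deriv01 s g x = deriv01 s (\<lambda>x. f x - c * g x) x"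
    using deriv01_diff_mult_top[OF assms, of c] by eventually_elim auto
  then show "L2_01 (deriv01 s (\<lambda>x. f x - c * g x))"
    by (rule L2_01_cong_AE[OF L2_01_diff_mult[OF sobolev_L2[OF f order_refl] sobolev_L2[OF g order_refl]]])
qed

lemma periodic_sobolev_diff_mult:
  assumes f: "f \<in> periodic_sobolev s" and g: "g \<in> periodic_sobolev s" and s: "s \<ge> 1"
  shows "(\<lambda>x. f x - c * g x) \<in> periodic_sobolev s"
proof -
  have fg: "f \<in> sobolev s" "g \<in> sobolev s" using f g by (auto simp: periodic_sobolev_def)
  then show ?thesis
    using f g sobolev_diff_mult[OF fg s] by (simp add: periodic_sobolev_def deriv01_diff_mult)
qed

section \<open>Fourier modes\<close>

text \<open>
  The eigenvalue of differentiation that belongs to the \<open>k\<close>-th mode.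
\<close>

definition freq :: "int \<Rightarrow> complex" where
  "freq k = 2 * of_real pi * \<i> * of_int k"

definition mode :: "int \<Rightarrow> real \<Rightarrow> complex" where
  "mode k x = exp (freq k * of_real x)"

lemma freq_0 [simp]: "freq 0 = 0" and freq_minus: "freq (- k) = - freq k"
  and cnj_freq: "cnj (freq k) = - freq k" and freq_eq_0_iff [simp]: "freq k = 0 \<longleftrightarrow> k = 0"
  by (simp_all add: freq_def)

lemma cnj_freq_mult_freq: "cnj (freq k) * freq k = of_real ((2 * pi * of_int k)\<^sup>2)"
  by (simp add: freq_def power2_eq_square algebra_simps)

lemma mode_at_0 [simp]: "mode k 0 = 1"
  by (simp add: mode_def)

lemma mode_at_1 [simp]: "mode k 1 = 1"
  by (auto simp: mode_def freq_def exp_eq_1 intro!: exI[of _ k])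

lemma mode_0 [simp]: "mode 0 x = 1"
  by (simp add: mode_def)

lemma cnj_mode: "cnj (mode k x) = mode (- k) x"
  by (simp add: mode_def exp_cnj cnj_freq freq_minus)

lemma mode_mult_mode_minus [simp]: "mode k x * mode (- k) x = 1"
  by (simp add: mode_def freq_minus exp_minus)

text \<open>
  The modes carry a scalar factor \<open>c\<close> in this and the following lemmas because
  both the representer and the extremal function of the initial error are scaled modes.
\<close>

lemma mode_deriv: "((\<lambda>x. c * mode k x) has_vector_derivative c * freq k * mode k x) (at x within S)"
proof -
  have "((\<lambda>z. c * exp (freq k * z)) has_field_derivative c * freq k * exp (freq k * of_real x)) (at (of_real x))"
    by (auto intro!: derivative_eq_intros)
  then show ?thesis unfolding mode_def by (rule has_vector_derivative_real_field)
qed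

lemma continuous_on_mode: "continuous_on S (mode k)"
  unfolding mode_def by (intro continuous_intros)

lemma abs_cont_on_mode: "abs_cont_on a b (\<lambda>x. c * mode k x)"
  by (rule abs_cont_on_C1[OF mode_deriv]) (intro continuous_intros continuous_on_mode)

lemma L2_01_mode: "L2_01 (\<lambda>x. c * mode k x)"
  by (intro L2_01_continuous continuous_intros continuous_on_mode)

lemma deriv01_mode:
  "x \<in> {0..1} \<Longrightarrow> deriv01 l (\<lambda>x. c * mode k x) x = c * freq k ^ l * mode k x"
proof (induction l arbitrary: x)
  case (Suc l)
  have "(deriv01 l (\<lambda>x. c * mode k x) has_vector_derivative c * freq k ^ l * freq k * mode k x) (at x within {0..1})"
    by (rule has_vector_derivative_transform[OF Suc.prems Suc.IH mode_deriv])
  from deriv01_SucI[OF this Suc.prems] show ?case by (simp add: mult_ac)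
qed simp

lemma mode_in_periodic_sobolev: "(\<lambda>x. c * mode k x) \<in> periodic_sobolev s"
proof -
  have "(deriv01 l (\<lambda>x. c * mode k x) has_vector_derivative c * freq k ^ l * freq k * mode k x) (at x within {0..1})"
    if "x \<in> {0..1}" for l x
    by (rule has_vector_derivative_transform[OF that deriv01_mode mode_deriv])
  then have diff: "deriv01 l (\<lambda>x. c * mode k x) differentiable (at x within {0..1})" if "x \<in> {0..1}" for l x
    using that by (metis differentiable_def has_vector_derivative_def)
  have "(\<lambda>x. c * mode k x) \<in> sobolev s"
  proof (rule sobolevI)
    show "abs_cont_on 0 1 (deriv01 (s - 1) (\<lambda>x. c * mode k x))"
      by (rule abs_cont_on_cong[OF abs_cont_on_mode deriv01_mode])
    show "L2_01 (deriv01 s (\<lambda>x. c * mode k x))"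
      by (rule L2_01_cong[OF L2_01_mode deriv01_mode])
  qed (use diff in auto)
  then show ?thesis by (simp add: periodic_sobolev_def deriv01_mode)
qed

lemma fourier_int_eq: "fourier_int k f = (LINT x:{0..1}|lebesgue. f x * mode (- k) x)"
  by (simp add: fourier_int_def mode_def freq_def)

lemma integral_mode: "(LINT x:{0..1}|lebesgue. mode k x) = (if k = 0 then 1 else 0)"
proof (cases "k = 0")
  case True
  then show ?thesis by (simp add: set_lebesgue_integral_def)
next
  case False
  have "(LINT x:{0..1}|lebesgue. 1 * freq k * mode k x) = 1 * mode k 1 - 1 * mode k 0"
    by (rule abs_cont_on_integral_deriv[OF _ abs_cont_on_mode negligible_empty mode_deriv
          L2_01_integrable[OF L2_01_mode]]) simp
  then show ?thesis using False by simp
qed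

text \<open>
  The function \<open>F\<close> times a mode is absolutely continuous with equal values at
  the end points, so its derivative has integral zero.
\<close>

lemma integral_by_parts_mode:
  assumes F: "abs_cont_on 0 1 F" and N: "negligible N"
    and F': "\<And>x. x \<in> {0..1} - N \<Longrightarrow> (F has_vector_derivative F' x) (at x within {0..1})"
    and L2: "L2_01 F'" and per: "F 0 = F 1"
  shows "fourier_int k F' = freq k * fourier_int k F"
proof -
  let ?e = "mode (- k)"
  have e: "((\<lambda>x. 1 * mode (- k) x) has_vector_derivative 1 * freq (- k) * ?e x) (at x within {0..1})" for x
    by (rule mode_deriv)
  have 1: "set_integrable lebesgue {0..1} (\<lambda>x. F' x * ?e x)"
    using L2_01_mult_integrable[OF L2 L2_01_mode[of 1]] by simp
  have 2: "set_integrable lebesgue {0..1} (\<lambda>x. F x * (freq (- k) * ?e x))"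
    by (intro absolutely_integrable_continuous_real continuous_intros continuous_on_mode
        abs_cont_on_imp_continuous_on F)
  have "(LINT x:{0..1}|lebesgue. F x * (freq (- k) * ?e x) + F' x * ?e x) = F 1 * ?e 1 - F 0 * ?e 0"
  proof (rule abs_cont_on_integral_deriv[OF _ _ N])
    show "abs_cont_on 0 1 (\<lambda>x. F x * ?e x)"
      using abs_cont_on_mult[OF F abs_cont_on_mode[of 0 1 1]] by simp
    show "((\<lambda>x. F x * ?e x) has_vector_derivative F x * (freq (- k) * ?e x) + F' x * ?e x)
        (at x within {0..1})" if "x \<in> {0..1} - N" for x
      using has_vector_derivative_mult[OF F'[OF that] e] by simp
    show "set_integrable lebesgue {0..1} (\<lambda>x. F x * (freq (- k) * ?e x) + F' x * ?e x)"
      using 1 2 by (rule set_integral_add(1)[rotated])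
  qed simp
  also have "\<dots> = 0" using per by simp
  also have "(LINT x:{0..1}|lebesgue. F x * (freq (- k) * ?e x) + F' x * ?e x)
      = (LINT x:{0..1}|lebesgue. freq (- k) * (F x * ?e x)) + fourier_int k F'"
    unfolding fourier_int_eq using set_integral_add(2)[OF 2 1] by (simp add: mult.left_commute)
  finally have "- (freq k * fourier_int k F) + fourier_int k F' = 0"
    by (simp only: set_integral_mult_right fourier_int_eq freq_minus minus_mult_left)
  from minus_unique[OF this] show ?thesis by simp
qed

lemma fourier_int_deriv01:
  assumes f: "f \<in> periodic_sobolev s" and "l \<le> s"
  shows "fourier_int k (deriv01 l f) = freq k ^ l * fourier_int k f"
  using assms(2)
proof (induction l)
  case (Suc l)
  have fs: "f \<in> sobolev s" and l: "l < s" using f Suc.prems by (auto simp: periodic_sobolev_def)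
  obtain N where "negligible N"
    "\<And>x. x \<in> {0..1} - N \<Longrightarrow> (deriv01 l f has_vector_derivative deriv01 (Suc l) f x) (at x within {0..1})"
    using sobolev_deriv[OF fs l] by blast
  then have "fourier_int k (deriv01 (Suc l) f) = freq k * fourier_int k (deriv01 l f)"
    using f l by (intro integral_by_parts_mode[OF sobolev_abs_cont[OF fs l]] sobolev_L2[OF fs Suc.prems])
      (auto simp: periodic_sobolev_def)
  then show ?case using Suc.IH l by simp
qed simp

text \<open>
  The squared Sobolev norm of the \<open>k\<close>-th mode.
\<close>

definition mode_weight :: "nat \<Rightarrow> int \<Rightarrow> real" where
  "mode_weight s k = (if k = 0 then 1 else (2 * pi * of_int k) ^ (2 * s))"

lemma mode_weight_pos: "0 < mode_weight s k"
  by (simp add: mode_weight_def zero_less_power_eq)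

text \<open>
  Pairing with a mode amounts to evaluating a Fourier coefficient. The means of the
  derivatives of the mode vanish unless \<open>k = 0\<close> and the order is
  \<open>0\<close>; at the top order \<open>s\<close> integrations by parts move all
  derivatives away from \<open>f\<close> and produce the factor \<open>\<bar>2 \<pi>
  k\<bar>\<^bsup>2s\<^esup>\<close>, which is zero for \<open>k = 0\<close>.
\<close>

lemma sobolev_inner_mode:
  assumes f: "f \<in> periodic_sobolev s" and s: "s \<ge> 1"
  shows "sobolev_inner s f (\<lambda>x. c * mode k x) = cnj c * of_real (mode_weight s k) * fourier_int k f"
proof -
  have low: "(LINT x:{0..1}|lebesgue. cnj (deriv01 l (\<lambda>x. c * mode k x) x))
      = cnj (c * freq k ^ l) * (if k = 0 then 1 else 0)" for l
  proof -
    have "(LINT x:{0..1}|lebesgue. cnj (deriv01 l (\<lambda>x. c * mode k x) x))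
        = cnj (LINT x:{0..1}|lebesgue. c * freq k ^ l * mode k x)"
      unfolding set_integral_cnj[symmetric]
      by (rule set_lebesgue_integral_cong) (auto simp: deriv01_mode)
    also have "\<dots> = cnj (c * freq k ^ l) * (if k = 0 then 1 else 0)"
      by (simp add: integral_mode)
    finally show ?thesis .
  qed
  have "(LINT x:{0..1}|lebesgue. deriv01 s f x * cnj (deriv01 s (\<lambda>x. c * mode k x) x))
      = (LINT x:{0..1}|lebesgue. cnj (c * freq k ^ s) * (deriv01 s f x * mode (- k) x))"
    by (rule set_lebesgue_integral_cong) (auto simp: deriv01_mode cnj_mode mult_ac)
  also have "\<dots> = cnj (c * freq k ^ s) * fourier_int k (deriv01 s f)"
    by (simp add: fourier_int_eq)
  also have "\<dots> = cnj c * (cnj (freq k) * freq k) ^ s * fourier_int k f"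
    by (simp add: fourier_int_deriv01[OF f] power_mult_distrib mult_ac)
  finally have top: "(LINT x:{0..1}|lebesgue. deriv01 s f x * cnj (deriv01 s (\<lambda>x. c * mode k x) x))
      = cnj c * of_real ((2 * pi * of_int k) ^ (2 * s)) * fourier_int k f"
    unfolding cnj_freq_mult_freq by (simp add: power_mult)
  show ?thesis
  proof (cases "k = 0")
    case True
    have "(\<Sum>l<s. (LINT x:{0..1}|lebesgue. deriv01 l f x) * cnj (c * freq k ^ l))
        = (\<Sum>l<s. if l = 0 then (LINT x:{0..1}|lebesgue. f x) * cnj c else 0)"
      using True by (intro sum.cong) auto
    also have "\<dots> = cnj c * fourier_int k f"
      using s True by (simp add: fourier_int_eq sum.delta)
    finally show ?thesis
      unfolding sobolev_inner_def low top using True s by (simp add: mode_weight_def)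
  next
    case False
    then show ?thesis unfolding sobolev_inner_def low top by (simp add: mode_weight_def)
  qed
qed

section \<open>The inner product\<close>

lemma sobolev_inner_commute: "sobolev_inner s g f = cnj (sobolev_inner s f g)"
  unfolding sobolev_inner_def by (simp add: set_integral_cnj[symmetric] mult.commute)

lemma sobolev_inner_self:
  "sobolev_inner s f f = of_real ((\<Sum>l<s. (norm (LINT x:{0..1}|lebesgue. deriv01 l f x))\<^sup>2) +
      (LINT x:{0..1}|lebesgue. (norm (deriv01 s f x))\<^sup>2))"
  unfolding sobolev_inner_def
  by (simp only: set_integral_cnj complex_norm_square[symmetric] set_integral_complex_of_real of_real_add of_real_sum)

lemma sobolev_inner_self_nonneg: "0 \<le> Re (sobolev_inner s f f)"
  unfolding sobolev_inner_self Re_complex_of_real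
  by (intro add_nonneg_nonneg sum_nonneg)
     (auto simp: set_lebesgue_integral_def intro!: Bochner_Integration.integral_nonneg)

lemma sobolev_inner_diff_mult_right:
  assumes f: "f \<in> sobolev s" and g: "g \<in> sobolev s" and h: "h \<in> sobolev s" and s: "s \<ge> 1"
  shows "sobolev_inner s f (\<lambda>x. g x - c * h x) = sobolev_inner s f g - cnj c * sobolev_inner s f h"
proof -
  let ?d = "\<lambda>x. g x - c * h x"
  have low: "(LINT x:{0..1}|lebesgue. cnj (deriv01 l ?d x)) =
      (LINT x:{0..1}|lebesgue. cnj (deriv01 l g x)) - cnj c * (LINT x:{0..1}|lebesgue. cnj (deriv01 l h x))"
    if "l < s" for l
  proof -
    have int: "set_integrable lebesgue {0..1} (deriv01 l g)" "set_integrable lebesgue {0..1} (\<lambda>x. c * deriv01 l h x)"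
      using sobolev_integrable[OF g] sobolev_integrable[OF h] that by auto
    have "(LINT x:{0..1}|lebesgue. deriv01 l ?d x) = (LINT x:{0..1}|lebesgue. deriv01 l g x - c * deriv01 l h x)"
      by (rule set_lebesgue_integral_cong) (use deriv01_diff_mult[OF g h that] in auto)
    also have "\<dots> = (LINT x:{0..1}|lebesgue. deriv01 l g x) - c * (LINT x:{0..1}|lebesgue. deriv01 l h x)"
      using set_integral_diff(2)[OF int] by simp
    finally show ?thesis by (simp add: set_integral_cnj)
  qed
  have int: "set_integrable lebesgue {0..1} (\<lambda>x. deriv01 s f x * cnj (deriv01 s g x))"
    "set_integrable lebesgue {0..1} (\<lambda>x. cnj c * (deriv01 s f x * cnj (deriv01 s h x)))"
    using f g h by (auto intro!: set_integrable_mult_right L2_01_mult_integrable L2_01_cnj sobolev_L2)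
  have "(LINT x:{0..1}|lebesgue. deriv01 s f x * cnj (deriv01 s g x) - cnj c * (deriv01 s f x * cnj (deriv01 s h x)))
      = (LINT x:{0..1}|lebesgue. deriv01 s f x * cnj (deriv01 s ?d x))"
  proof (rule set_lebesgue_integral_AE_eq)
    show "AE x\<in>{0..1} in lebesgue. deriv01 s f x * cnj (deriv01 s g x) - cnj c * (deriv01 s f x * cnj (deriv01 s h x))
        = deriv01 s f x * cnj (deriv01 s ?d x)"
      using deriv01_diff_mult_top[OF g h s, of c] by eventually_elim (auto simp: right_diff_distrib mult_ac)
    show "set_borel_measurable lebesgue {0..1}
        (\<lambda>x. deriv01 s f x * cnj (deriv01 s g x) - cnj c * (deriv01 s f x * cnj (deriv01 s h x)))"
      by (rule set_integrable_imp_measurable[OF set_integral_diff(1)[OF int]])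
  qed
  then have top: "(LINT x:{0..1}|lebesgue. deriv01 s f x * cnj (deriv01 s ?d x)) =
      (LINT x:{0..1}|lebesgue. deriv01 s f x * cnj (deriv01 s g x)) -
      cnj c * (LINT x:{0..1}|lebesgue. deriv01 s f x * cnj (deriv01 s h x))"
    using set_integral_diff(2)[OF int] by simp
  have "(\<Sum>l<s. (LINT x:{0..1}|lebesgue. deriv01 l f x) * (LINT x:{0..1}|lebesgue. cnj (deriv01 l ?d x)))
      = (\<Sum>l<s. (LINT x:{0..1}|lebesgue. deriv01 l f x) * (LINT x:{0..1}|lebesgue. cnj (deriv01 l g x)))
      - cnj c * (\<Sum>l<s. (LINT x:{0..1}|lebesgue. deriv01 l f x) * (LINT x:{0..1}|lebesgue. cnj (deriv01 l h x)))"
    unfolding sum_distrib_left sum_subtractf[symmetric]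
    by (rule sum.cong) (simp_all add: low algebra_simps)
  then show ?thesis unfolding sobolev_inner_def top by (simp add: algebra_simps)
qed

text \<open>
  If the norm of \<open>f\<close> vanishes, then so do the top derivative, almost
  everywhere, and the means of all lower ones. Descending in the order, a function with
  vanishing derivative is constant, and a constant with mean zero is zero.
\<close>

lemma sobolev_inner_definite:
  assumes f: "f \<in> sobolev s" and s: "s \<ge> 1" and zero: "sobolev_inner s f f = 0" and x: "x \<in> {0..1}"
  shows "f x = 0"
proof -
  let ?top = "LINT x:{0..1}|lebesgue. (norm (deriv01 s f x))\<^sup>2"
  have "0 \<le> ?top" by (auto simp: set_lebesgue_integral_def intro!: Bochner_Integration.integral_nonneg)
  moreover have "0 \<le> (\<Sum>l<s. (norm (LINT x:{0..1}|lebesgue. deriv01 l f x))\<^sup>2)" by (simp add: sum_nonneg)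
  moreover have "(\<Sum>l<s. (norm (LINT x:{0..1}|lebesgue. deriv01 l f x))\<^sup>2) + ?top = 0"
    using zero unfolding sobolev_inner_self of_real_eq_0_iff .
  ultimately have top: "?top = 0" and "(\<Sum>l<s. (norm (LINT x:{0..1}|lebesgue. deriv01 l f x))\<^sup>2) = 0"
    by linarith+
  then have mean: "(LINT x:{0..1}|lebesgue. deriv01 l f x) = 0" if "l < s" for l
    using that by (simp add: sum_nonneg_eq_0_iff)
  have "integrable lebesgue (\<lambda>x. indicator {0..1} x *\<^sub>R (norm (deriv01 s f x))\<^sup>2)"
    using sobolev_L2[OF f order_refl] by (simp add: L2_01_def set_integrable_def)
  then have "AE x in lebesgue. indicator {0..1} x *\<^sub>R (norm (deriv01 s f x))\<^sup>2 = 0"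
    using top unfolding set_lebesgue_integral_def by (subst (asm) integral_nonneg_eq_0_iff_AE) auto
  then have "AE x\<in>{0..1} in lebesgue. deriv01 s f x = 0"
    by eventually_elim (auto simp: indicator_def)
  then have top0: "\<exists>N. negligible N \<and> (\<forall>x\<in>{0..1} - N. deriv01 s f x = 0)"
    unfolding eventually_ae_filter_negligible by blast
  have descend: "deriv01 l f x = 0"
    if vanish: "\<exists>N. negligible N \<and> (\<forall>x\<in>{0..1} - N. deriv01 (Suc l) f x = 0)"
      and l: "l < s" and x: "x \<in> {0..1}" for l x
  proof -
    from vanish obtain N where N: "negligible N" "\<And>x. x \<in> {0..1} - N \<Longrightarrow> deriv01 (Suc l) f x = 0" by blast
    obtain N' where N': "negligible N'"
      "\<And>x. x \<in> {0..1} - N' \<Longrightarrow> (deriv01 l f has_vector_derivative deriv01 (Suc l) f x) (at x within {0..1})"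
      using sobolev_deriv[OF f l] by blast
    have const: "deriv01 l f y = deriv01 l f 0" if y: "y \<in> {0..1}" for y
    proof (rule abs_cont_on_deriv_zero[OF sobolev_abs_cont[OF f l] negligible_Un[OF N(1) N'(1)] _ y])
      fix z assume "z \<in> {0..1} - (N \<union> N')"
      then show "(deriv01 l f has_vector_derivative 0) (at z within {0..1})"
        using N(2)[of z] N'(2)[of z] by simp
    qed
    have "(LINT x:{0..1}|lebesgue. deriv01 l f x) = (LINT x:{0..1::real}|lebesgue. deriv01 l f 0)"
      by (rule set_lebesgue_integral_cong) (simp, blast intro: const)
    also have "\<dots> = deriv01 l f 0" by (simp add: set_lebesgue_integral_def)
    finally show "deriv01 l f x = 0" using mean[OF l] const[OF x] by simp
  qed
  have "\<exists>N. negligible N \<and> (\<forall>x\<in>{0..1} - N. deriv01 l f x = 0)" if "l \<le> s" for l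
    using that
  proof (induction rule: inc_induct)
    case (step l)
    have "\<forall>x\<in>{0..1} - {}. deriv01 l f x = 0"
      using descend[OF step.IH step.hyps(2)] by blast
    then show ?case using negligible_empty by blast
  qed (rule top0)
  from descend[OF this, of 0 x] show ?thesis using s x by simp
qed

section \<open>Bessel's inequality, the representer and the initial error\<close>

lemma fourier_int_diff_mult:
  assumes "f \<in> sobolev s" "g \<in> sobolev s"
  shows "fourier_int k (\<lambda>x. f x - c * g x) = fourier_int k f - c * fourier_int k g"
proof -
  have "L2_01 f" "L2_01 g" using assms sobolev_L2[of _ s 0] by auto
  then have int: "set_integrable lebesgue {0..1} (\<lambda>x. f x * mode (- k) x)"
    "set_integrable lebesgue {0..1} (\<lambda>x. c * (g x * mode (- k) x))"
    using L2_01_mult_integrable[OF _ L2_01_mode[of 1]] by simp_all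
  show ?thesis
    using set_integral_diff(2)[OF int] by (simp add: fourier_int_eq left_diff_distrib mult.assoc)
qed

lemma fourier_int_mode: "fourier_int k (\<lambda>x. c * mode k x) = c"
  by (simp add: fourier_int_eq mult.assoc) (simp add: set_lebesgue_integral_def)

text \<open>
  The left-hand side is the squared norm of the projection of \<open>f\<close> onto the
  \<open>k\<close>-th mode; the inequality says that the squared norm of the remainder is
  nonnegative.
\<close>

lemma sobolev_bessel:
  assumes f: "f \<in> periodic_sobolev s" and s: "s \<ge> 1"
  shows "mode_weight s k * (norm (fourier_int k f))\<^sup>2 \<le> Re (sobolev_inner s f f)"
proof -
  let ?c = "fourier_int k f" and ?w = "mode_weight s k"
  \<comment> \<open>The factor \<open>1\<close> gives \<open>e\<close> the shape of the scaled modes to which the lemmas above apply.\<close>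
  define e where "e = (\<lambda>x. 1 * mode k x)"
  define g where "g = (\<lambda>x. f x - ?c * e x)"
  have e: "e \<in> periodic_sobolev s" unfolding e_def by (rule mode_in_periodic_sobolev)
  have g: "g \<in> periodic_sobolev s" unfolding g_def by (rule periodic_sobolev_diff_mult[OF f e s])
  have sob: "f \<in> sobolev s" "e \<in> sobolev s" "g \<in> sobolev s"
    using f e g by (auto simp: periodic_sobolev_def)
  have inner_e: "sobolev_inner s u e = of_real ?w * fourier_int k u" if "u \<in> periodic_sobolev s" for u
    unfolding e_def using sobolev_inner_mode[OF that s, of 1 k] by simp
  have "fourier_int k e = 1" unfolding e_def by (rule fourier_int_mode)
  then have "fourier_int k g = 0"
    unfolding g_def using fourier_int_diff_mult[OF sob(1,2)] by simp
  have "sobolev_inner s g g = sobolev_inner s g f - cnj ?c * sobolev_inner s g e"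
    using sobolev_inner_diff_mult_right[OF sob(3) sob(1) sob(2) s, of ?c] by (simp only: g_def)
  also have "\<dots> = sobolev_inner s g f"
    using inner_e[OF g] \<open>fourier_int k g = 0\<close> by simp
  also have "\<dots> = cnj (sobolev_inner s f g)" by (rule sobolev_inner_commute)
  also have "sobolev_inner s f g = sobolev_inner s f f - cnj ?c * sobolev_inner s f e"
    using sobolev_inner_diff_mult_right[OF sob(1) sob(1) sob(2) s, of ?c] by (simp only: g_def)
  also have "cnj ?c * sobolev_inner s f e = of_real (?w * (norm ?c)\<^sup>2)"
    unfolding inner_e[OF f] of_real_mult complex_norm_square by (simp only: mult_ac)
  finally have "Re (sobolev_inner s g g) = Re (sobolev_inner s f f) - ?w * (norm ?c)\<^sup>2"
    by simp
  with sobolev_inner_self_nonneg[of s g] show ?thesis by simp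
qed

lemma is_representer_mode:
  assumes "s \<ge> 1"
  shows "is_representer k s (\<lambda>x. of_real (1 / mode_weight s k) * mode k x)"
  unfolding is_representer_def
  using sobolev_inner_mode[OF _ assms, of _ "of_real (1 / mode_weight s k)" k] mode_weight_pos[of s k]
    mode_in_periodic_sobolev[of "of_real (1 / mode_weight s k)" k s]
  by (auto simp flip: of_real_mult)

lemma is_representer_cong:
  assumes h: "is_representer k s h" and eq: "\<And>x. x \<in> {0..1} \<Longrightarrow> h' x = h x"
  shows "is_representer k s h'"
  unfolding is_representer_def
proof (intro conjI ballI)
  show "h' \<in> periodic_sobolev s"
    using h eq periodic_sobolev_cong by (auto simp: is_representer_def)
  have "sobolev_inner s f h' = sobolev_inner s f h" for f
    by (rule sobolev_inner_cong[OF refl eq])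
  then show "fourier_int k f = sobolev_inner s f h'" if "f \<in> periodic_sobolev s" for f
    using h that by (simp add: is_representer_def)
qed

text \<open>
  The difference \<open>g\<close> of two representers has the same inner product with both
  of them, hence is orthogonal to itself.
\<close>

lemma is_representer_unique:
  assumes h: "is_representer k s h" and r: "is_representer k s r" and s: "s \<ge> 1" and x: "x \<in> {0..1}"
  shows "h x = r x"
proof -
  define g where "g = (\<lambda>x. h x - 1 * r x)"
  have eq: "sobolev_inner s f h = sobolev_inner s f r" if "f \<in> periodic_sobolev s" for f
    using h r that by (auto simp: is_representer_def)
  have g: "g \<in> periodic_sobolev s"
    unfolding g_def using h r by (intro periodic_sobolev_diff_mult s) (auto simp: is_representer_def)
  have sob: "g \<in> sobolev s" "h \<in> sobolev s" "r \<in> sobolev s"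
    using h r g by (auto simp: is_representer_def periodic_sobolev_def)
  have "sobolev_inner s g g = sobolev_inner s g h - cnj 1 * sobolev_inner s g r"
    using sobolev_inner_diff_mult_right[OF sob s, of 1] by (simp only: g_def)
  also have "\<dots> = 0" using eq[OF g] by simp
  finally have "g x = 0" by (rule sobolev_inner_definite[OF sob(1) s _ x])
  then show ?thesis by (simp add: g_def)
qed

lemma is_representer_iff:
  assumes "s \<ge> 1"
  shows "is_representer k s h \<longleftrightarrow> (\<forall>x\<in>{0..1}. h x = of_real (1 / mode_weight s k) * mode k x)"
  using is_representer_unique[OF _ is_representer_mode[OF assms] assms]
    is_representer_cong[OF is_representer_mode[OF assms]] by metis

lemma sobolev_norm_mode:
  assumes "s \<ge> 1"
  shows "sobolev_norm s (\<lambda>x. c * mode k x) = norm c * sqrt (mode_weight s k)"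
proof -
  have "sobolev_inner s (\<lambda>x. c * mode k x) (\<lambda>x. c * mode k x) = of_real (mode_weight s k * (norm c)\<^sup>2)"
    unfolding sobolev_inner_mode[OF mode_in_periodic_sobolev assms] fourier_int_mode
      of_real_mult complex_norm_square by (simp only: mult_ac)
  then show ?thesis by (simp add: sobolev_norm_def real_sqrt_mult)
qed

lemma sobolev_norm_representer:
  assumes h: "is_representer k s h" and s: "s \<ge> 1"
  shows "sobolev_norm s h = 1 / sqrt (mode_weight s k)"
proof -
  let ?r = "\<lambda>x. of_real (1 / mode_weight s k) * mode k x"
  have eq: "h x = ?r x" if "x \<in> {0..1}" for x
    using h that unfolding is_representer_iff[OF s] by blast
  have "sobolev_norm s h = sobolev_norm s ?r"
    unfolding sobolev_norm_def by (simp only: sobolev_inner_cong[OF eq eq])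
  also have "\<dots> = 1 / sqrt (mode_weight s k)"
    unfolding sobolev_norm_mode[OF s] norm_of_real
    using mode_weight_pos[of s k] by (simp add: field_simps)
  finally show ?thesis .
qed

text \<open>
  Bessel's inequality gives the upper bound, and the mode scaled to norm one attains it.
\<close>

lemma initial_error_eq:
  assumes s: "s \<ge> 1"
  shows "initial_error k s = ereal (1 / sqrt (mode_weight s k))"
  unfolding initial_error_def
proof (rule antisym)
  let ?w = "mode_weight s k"
  have w: "0 < ?w" by (rule mode_weight_pos)
  show "(SUP f\<in>{f \<in> periodic_sobolev s. sobolev_norm s f \<le> 1}. ereal (norm (fourier_int k f))) \<le> ereal (1 / sqrt ?w)"
  proof (rule SUP_least, clarify)
    fix f assume f: "f \<in> periodic_sobolev s" and "sobolev_norm s f \<le> 1"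
    then have "Re (sobolev_inner s f f) \<le> 1" by (simp add: sobolev_norm_def)
    with sobolev_bessel[OF f s, of k] have "?w * (norm (fourier_int k f))\<^sup>2 \<le> 1" by linarith
    then have "(norm (fourier_int k f))\<^sup>2 \<le> 1 / ?w" using w by (simp add: field_simps)
    then have "norm (fourier_int k f) \<le> sqrt (1 / ?w)" by (rule real_le_rsqrt)
    then show "ereal (norm (fourier_int k f)) \<le> ereal (1 / sqrt ?w)" by (simp add: real_sqrt_divide)
  qed
  let ?f = "\<lambda>x. of_real (1 / sqrt ?w) * mode k x"
  have "norm (fourier_int k ?f) = 1 / sqrt ?w"
    unfolding fourier_int_mode norm_of_real using w by simp
  moreover have "sobolev_norm s ?f \<le> 1"
    unfolding sobolev_norm_mode[OF s] norm_of_real using w by simp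
  ultimately show "ereal (1 / sqrt ?w) \<le> (SUP f\<in>{f \<in> periodic_sobolev s. sobolev_norm s f \<le> 1}. ereal (norm (fourier_int k f)))"
    using mode_in_periodic_sobolev[of "of_real (1 / sqrt ?w)" k s] by (intro SUP_upper2[of ?f]) auto
qed

theorem proposition3:
  fixes s :: nat and k :: int
  assumes "s \<ge> 1"
  shows "(k \<noteq> 0 \<longrightarrow>
            (\<forall>h. is_representer k s h \<longleftrightarrow>
               (\<forall>x\<in>{0..1}. h x = of_real ((2 * pi * of_int k) powi (- 2 * int s)) *
                              exp (2 * of_real pi * \<i> * of_int k * of_real x))) \<and>
            (\<forall>h. is_representer k s h \<longrightarrow>
               initial_error k s = ereal (sobolev_norm s h) \<and>
               sobolev_norm s h = 1 / (2 * pi * \<bar>of_int k\<bar>) ^ s))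
       \<and> (k = 0 \<longrightarrow>
            (\<forall>h. is_representer k s h \<longleftrightarrow> (\<forall>x\<in>{0..1}. h x = 1)) \<and>
            initial_error k s = 1)"
proof (intro conjI impI allI)
  fix h
  assume k: "k \<noteq> 0"
  have "(2 * pi * of_int k) powi (- 2 * int s) = inverse ((2 * pi * of_int k) powi (2 * int s))"
    by (simp add: power_int_minus)
  also have "(2 * pi * of_int k) powi (2 * int s) = (2 * pi * of_int k) ^ (2 * s)"
    by (metis power_int_of_nat of_nat_mult of_nat_numeral)
  finally have w: "(2 * pi * of_int k) powi (- 2 * int s) = 1 / mode_weight s k"
    using k by (simp add: mode_weight_def divide_inverse)
  show "is_representer k s h \<longleftrightarrow>
      (\<forall>x\<in>{0..1}. h x = of_real ((2 * pi * of_int k) powi (- 2 * int s)) *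
                     exp (2 * of_real pi * \<i> * of_int k * of_real x))"
    unfolding is_representer_iff[OF assms] w mode_def freq_def ..
next
  fix h
  assume k: "k \<noteq> 0" and h: "is_representer k s h"
  show "initial_error k s = ereal (sobolev_norm s h)"
    unfolding initial_error_eq[OF assms] sobolev_norm_representer[OF h assms] ..
  have "mode_weight s k = ((2 * pi * of_int k)\<^sup>2) ^ s"
    using k by (simp add: mode_weight_def power_mult)
  also have "\<dots> = ((2 * pi * \<bar>of_int k\<bar>)\<^sup>2) ^ s" by (simp add: power_mult_distrib)
  also have "\<dots> = ((2 * pi * \<bar>of_int k\<bar>) ^ s)\<^sup>2" by (metis power_mult mult.commute)
  finally have "mode_weight s k = ((2 * pi * \<bar>of_int k\<bar>) ^ s)\<^sup>2" .
  then have "sqrt (mode_weight s k) = (2 * pi * \<bar>of_int k\<bar>) ^ s" by simp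
  then show "sobolev_norm s h = 1 / (2 * pi * \<bar>of_int k\<bar>) ^ s"
    by (simp only: sobolev_norm_representer[OF h assms])
next
  fix h
  assume "k = 0"
  then show "is_representer k s h \<longleftrightarrow> (\<forall>x\<in>{0..1}. h x = 1)"
    by (simp add: is_representer_iff[OF assms] mode_weight_def)
next
  assume "k = 0"
  then show "initial_error k s = 1"
    by (simp add: initial_error_eq[OF assms] mode_weight_def one_ereal_def)
qed

end
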